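(* Let $p>-1$ be real, let $n\geq 1$ be an integer, and put $\zeta=j_{p,n}^2$. Then the Taylor coefficients $\alpha_k=A_p^{(k)}(\zeta)/k!$ ($k\ge 0$) of $A_p$ at $\zeta$ satisfy $\alpha_0=0$, $\alpha_1=-\dfrac{1}{2\zeta}$, and for every integer $k\geq 1$ $$\alpha_{k+1}=-\frac{1}{2\zeta(k+1)}\left[2(k-p)\alpha_k+\zeta\sum_{j=1}^{k-1}\alpha_j\alpha_{k-j}+\sum_{j=1}^{k-2}\alpha_j\alpha_{k-1-j}\right],$$ where empty sums are zero. Moreover, for every integer $r\geq 2$, $$\sum_{m\geq1}\frac{j_{p,n}^{2}\,j_{p+1,m}^{2}}{\left(j_{p+1,m}^{2}-j_{p,n}^{2}\right)^{r}}=-\frac12\left(j_{p,n}^2\,\alpha_{r-2}+j_{p,n}^4\,\alpha_{r-1}\right).$$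
   Context: For real $\nu>-1$, $J_\nu$ is the Bessel function of the first kind of order $\nu$ and $j_{\nu,m}$ denotes its $m$th positive zero ($m\ge1$). The function $A_p$ is $$A_p(x)=\frac{J_p(\sqrt{x})}{\sqrt{x}\,J_{p+1}(\sqrt{x})},$$ defined for $x>0$ with $J_{p+1}(\sqrt x)\neq0$; since $J_p$ and $J_{p+1}$ have no common positive zeros, $A_p$ is analytic in a neighbourhood of $j_{p,n}^2$. *)

theory Defs
  imports "HOL-Analysis.Analysis"
begin

text \<open>
  The Bessel function of the first kind of real order, by its defining power series
  \<open>(x/2)\<^sup>\<nu> \<Sum> (-1)\<^sup>k / (k! \<Gamma>(\<nu>+k+1)) (x/2)\<^sup>2\<^sup>k\<close>.
  Because of \<open>powr\<close>, the definition is only meaningful for \<open>x > 0\<close>.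
\<close>

definition bessel_J :: "real \<Rightarrow> real \<Rightarrow> real" where
  "bessel_J \<nu> x =
     (\<Sum>k. (-1) ^ k / (fact k * Gamma (\<nu> + real k + 1)) * (x / 2) powr (\<nu> + 2 * real k))"

text \<open>
  The \<open>m\<close>-th positive zero, counted from \<open>m = 1\<close>. Positive zeros of \<open>bessel_J \<nu>\<close>
  are simple, so counting them without multiplicity is no restriction. For \<open>m \<ge> 1\<close> the
  cardinality condition forces the set of zeros up to \<open>x\<close> to be finite; for \<open>m = 0\<close>
  the value is unspecified.
\<close>

definition bessel_zero :: "real \<Rightarrow> nat \<Rightarrow> real" where
  "bessel_zero \<nu> m =
     (THE x. 0 < x \<and> bessel_J \<nu> x = 0 \<and> card {y. 0 < y \<and> y \<le> x \<and> bessel_J \<nu> y = 0} = m)"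

definition bessel_A :: "real \<Rightarrow> real \<Rightarrow> real" where
  "bessel_A p x = bessel_J p (sqrt x) / (sqrt x * bessel_J (p + 1) (sqrt x))"

end

theory Submission
  imports Defs "HOL-Library.Diagonal_Subsequence"
begin

text \<open>
  Up to an elementary factor, \<open>J\<^sub>\<nu>(\<surd>x)\<close> is an entire function \<open>f\<close> of \<open>x\<close>. It is the limit of rescaled
  Jacobi polynomials, which by Rodrigues' formula and Rolle's theorem have only simple positive
  roots. Their inverse roots have constant sum, so along a subsequence they converge one by one, and
  \<open>f' / f\<close> becomes the sum of \<open>- 1 / (z\<^sub>j - x)\<close> over the zeros, up to a constant. Comparing with the
  power series at \<open>-\<infinity>\<close> shows that this constant vanishes and that there are infinitely many zeros.

  For \<open>\<nu> = p + 1\<close> this gives \<open>A\<^sub>p(x) = 2 (p + 1) / x - 2 \<Sum>\<^sub>m 1 / (j\<^sub>m\<^sup>2 - x)\<close>, so the Taylor coefficients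
  of \<open>A\<^sub>p\<close> at \<open>\<zeta>\<close> are power sums of \<open>1 / (j\<^sub>m\<^sup>2 - \<zeta>)\<close> plus a multiple of \<open>(-1)\<^sup>k / \<zeta>\<^sup>k\<^sup>+\<^sup>1\<close> that cancels
  in \<open>\<zeta> \<alpha>\<^bsub>r-2\<^esub> + \<zeta>\<^sup>2 \<alpha>\<^bsub>r-1\<^esub>\<close>. The recurrence is the Riccati equation \<open>2 x A' = 2 p A - 1 - x A\<^sup>2\<close> read off
  coefficientwise.
\<close>

section \<open>Roots of Jacobi polynomials\<close>

text \<open>Rolle's theorem between consecutive points of \<open>S\<close>, by removing the largest
  one. Confining \<open>R\<close> to points below \<open>Max S\<close>, and not merely below
  \<open>u\<close>, makes the zero found between the two largest points of \<open>S\<close> differ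
  from those of the induction hypothesis.\<close>

lemma Rolle_finite_set:
  fixes g g' :: "real \<Rightarrow> real"
  assumes "continuous_on {l..u} g"
    and "\<And>x. l < x \<Longrightarrow> x < u \<Longrightarrow> (g has_real_derivative g' x) (at x)"
    and "finite S" "card S = Suc m" "S \<subseteq> {l..u}" "\<And>x. x \<in> S \<Longrightarrow> g x = 0"
  shows "\<exists>R. finite R \<and> card R = m \<and> R \<subseteq> {l<..<Max S} \<and> (\<forall>x\<in>R. g' x = 0)"
  using assms(3-)
proof (induction m arbitrary: S)
  case 0
  show ?case by (rule exI[of _ "{}"]) auto
next
  case (Suc m)
  define M where "M = Max S"
  define S' where "S' = S - {M}"
  have "S \<noteq> {}" using Suc.prems by auto
  then have M: "M \<in> S" using Suc.prems Max_in M_def by blast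
  have S': "finite S'" "card S' = Suc m" "S' \<subseteq> {l..u}" "\<And>x. x \<in> S' \<Longrightarrow> g x = 0"
    using Suc.prems M by (auto simp: S'_def)
  obtain R where R: "finite R" "card R = m" "R \<subseteq> {l<..<Max S'}" "\<forall>x\<in>R. g' x = 0"
    using Suc.IH[OF S'] by blast
  have ne: "S' \<noteq> {}" using S' by auto
  then have M': "Max S' \<in> S'" using S' by auto
  have lt: "Max S' < M"
    using M' Suc.prems(1) Max_ge[of S "Max S'"] by (auto simp: S'_def M_def less_le)
  have bounds: "l \<le> Max S'" "M \<le> u" using M M' S' Suc.prems by auto
  have "\<exists>z>Max S'. z < M \<and> (*) (g' z) = (\<lambda>v. 0)"
  proof -
    have "continuous_on {Max S'..M} g"
      using assms(1) by (rule continuous_on_subset) (use bounds in auto)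
    moreover have "(g has_derivative (*) (g' x)) (at x)" if "Max S' < x" "x < M" for x
      using assms(2)[of x] that bounds by (auto simp: has_field_derivative_def)
    moreover have "g (Max S') = g M" using S'(4)[OF M'] Suc.prems(4)[OF M] by simp
    ultimately show ?thesis
      using Rolle_deriv[OF lt, of g "\<lambda>x. (*) (g' x)"] by metis
  qed
  then obtain z where z: "Max S' < z" "z < M" "(*) (g' z) = (\<lambda>v. 0)" by blast
  have gz: "g' z = 0" using fun_cong[OF z(3), of 1] by simp
  have "z \<notin> R" using R(3) z(1) by auto
  moreover have "insert z R \<subseteq> {l<..<M}" using R(3) z lt bounds by force
  ultimately show ?case using R gz
    by (intro exI[of _ "insert z R"]) (auto simp: M_def)
qed

definition jacobi_coeff :: "nat \<Rightarrow> real \<Rightarrow> real \<Rightarrow> nat \<Rightarrow> real" where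
  "jacobi_coeff n a b k = pochhammer (- real n) k * pochhammer (real n + a + b + 1) k /
     (pochhammer (a + 1) k * fact k)"

text \<open>The hypergeometric form \<open>\<^sub>2F\<^sub>1(-n, n + a + b + 1; a + 1; x)\<close>: orthogonal on \<open>[0, 1]\<close> for the
  weight \<open>x\<^sup>a (1 - x)\<^sup>b\<close> and equal to \<open>1\<close> at the origin.\<close>
definition jacobi_poly :: "nat \<Rightarrow> real \<Rightarrow> real \<Rightarrow> real poly" where
  "jacobi_poly n a b = (\<Sum>k\<le>n. monom (jacobi_coeff n a b k) k)"

lemma jacobi_coeff_0 [simp]: "jacobi_coeff n a b 0 = 1"
  by (simp add: jacobi_coeff_def)

lemma jacobi_coeff_eq_0: "n < k \<Longrightarrow> jacobi_coeff n a b k = 0"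
  by (simp add: jacobi_coeff_def pochhammer_of_nat_eq_0_lemma)

lemma coeff_jacobi_poly: "coeff (jacobi_poly n a b) k = jacobi_coeff n a b k"
  by (auto simp: jacobi_poly_def coeff_sum jacobi_coeff_eq_0)

lemma degree_jacobi_poly: "degree (jacobi_poly n a b) \<le> n"
  by (intro degree_le) (auto simp: coeff_jacobi_poly jacobi_coeff_eq_0)

lemma poly_jacobi_poly_0 [simp]: "poly (jacobi_poly n a b) 0 = 1"
  by (simp add: poly_0_coeff_0 coeff_jacobi_poly)

text \<open>All three coefficients are multiples of the same product \<open>C\<close>. Once it is
  cancelled, the polynomial identity \<open>- (n + 1) * (M - 1) = (i - n) * (M + i) - (i + 1) * (i +
  a + b + 2)\<close> remains.\<close>

lemma jacobi_coeff_Suc: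
  assumes "a > -1"
  shows "(a + 1) * jacobi_coeff (Suc n) a b (Suc i) =
    (real i + a + 2) * jacobi_coeff n (a + 1) (b + 1) (Suc i)
    - (real i + a + b + 2) * jacobi_coeff n (a + 1) (b + 1) i"
proof -
  define M where "M = real n + a + b + 3"
  define C where "C = pochhammer (- real n) i * pochhammer M i / (pochhammer (a + 2) i * fact i)"
  have pos: "pochhammer (a + 2) i > 0" "a + 2 + real i > 0" "a + 1 > 0"
    using assms by (auto intro!: pochhammer_pos)
  have 1: "jacobi_coeff n (a + 1) (b + 1) i = C"
    by (simp add: jacobi_coeff_def C_def M_def add_ac)
  have "jacobi_coeff n (a + 1) (b + 1) (Suc i) =
     pochhammer (- real n) (Suc i) * pochhammer M (Suc i) / (pochhammer (a + 2) (Suc i) * fact (Suc i))"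
    by (simp add: jacobi_coeff_def M_def add_ac)
  also have "\<dots> = C * ((real i - real n) * (M + i) / ((a + 2 + i) * (i + 1)))"
    using pos by (simp add: C_def pochhammer_Suc field_simps)
  finally have 2: "jacobi_coeff n (a + 1) (b + 1) (Suc i) = \<dots>" .
  have e: "real (Suc n) + a + b + 1 = M - 1" by (simp add: M_def)
  have "pochhammer (- real (Suc n)) (Suc i) = (- real n - 1) * pochhammer (- real n) i"
    using pochhammer_rec[of "- real (Suc n)" i] by simp
  moreover have "pochhammer (M - 1) (Suc i) = (M - 1) * pochhammer M i"
    using pochhammer_rec[of "M - 1" i] by simp
  moreover have "pochhammer (a + 1) (Suc i) = (a + 1) * pochhammer (a + 2) i"
    using pochhammer_rec[of "a + 1" i] by (simp add: add_ac)
  ultimately have "jacobi_coeff (Suc n) a b (Suc i) =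
     ((- real n - 1) * pochhammer (- real n) i) * ((M - 1) * pochhammer M i) /
     (((a + 1) * pochhammer (a + 2) i) * fact (Suc i))"
    by (simp only: jacobi_coeff_def e)
  also have "\<dots> = C * ((- real n - 1) * (M - 1) / ((a + 1) * (i + 1)))"
    using pos by (simp add: C_def field_simps)
  finally have 3: "jacobi_coeff (Suc n) a b (Suc i) = \<dots>" .
  have *: "(real i + a + 2) * ((real i - real n) * (M + i) / ((a + 2 + i) * (i + 1))) =
     (real i - real n) * (M + i) / (i + 1)"
  proof -
    have e': "real i + a + 2 = a + 2 + i" by simp
    show ?thesis unfolding e' using pos(2) by simp
  qed
  have **: "(a + 1) * ((- real n - 1) * (M - 1) / ((a + 1) * (i + 1))) = (- real n - 1) * (M - 1) / (i + 1)"
    using pos by simp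
  have "(- real n - 1) * (M - 1) / (i + 1) = (real i - real n) * (M + i) / (i + 1) - (real i + a + b + 2)"
    by (simp add: field_simps M_def)
  then have "C * ((a + 1) * ((- real n - 1) * (M - 1) / ((a + 1) * (i + 1)))) =
     C * ((real i + a + 2) * ((real i - real n) * (M + i) / ((a + 2 + i) * (i + 1)))) - C * (real i + a + b + 2)"
    unfolding * ** by (simp add: right_diff_distrib)
  then show ?thesis unfolding 1 2 3 by (simp only: mult_ac)
qed

text \<open>One step of Rodrigues' formula: multiplied by \<open>x^a (1 - x)^b\<close>, the
  right-hand side is the derivative of \<open>x^(a+1) (1 - x)^(b+1) P(x)\<close> with
  \<open>P = jacobi_poly n (a + 1) (b + 1)\<close>.\<close>

lemma jacobi_poly_Suc:
  assumes "a > -1"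
  shows "smult (a + 1) (jacobi_poly (Suc n) a b) =
    [:0, 1, -1:] * pderiv (jacobi_poly n (a + 1) (b + 1))
    + [:a + 1, - (a + b + 2):] * jacobi_poly n (a + 1) (b + 1)"
proof (rule poly_eqI)
  fix k
  show "coeff (smult (a + 1) (jacobi_poly (Suc n) a b)) k = coeff ([:0, 1, -1:] * pderiv (jacobi_poly n (a + 1) (b + 1))
    + [:a + 1, - (a + b + 2):] * jacobi_poly n (a + 1) (b + 1)) k"
  proof (cases k)
    case 0
    then show ?thesis by (simp add: coeff_jacobi_poly)
  next
    case (Suc i)
    show ?thesis unfolding Suc
      using jacobi_coeff_Suc[OF assms, of n b i]
      by (cases i) (simp_all add: coeff_jacobi_poly coeff_pderiv algebra_simps)
  qed
qed

text \<open>Rodrigues' formula exhibits \<open>x\<^sup>a (1 - x)\<^sup>b P\<^bsub>n+1\<^esub>\<close> as a derivative of a function that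
  vanishes at \<open>0\<close>, at \<open>1\<close> and at the roots of \<open>P\<^sub>n\<close> for the parameters \<open>a + 1\<close>, \<open>b + 1\<close>.\<close>
lemma jacobi_poly_roots:
  fixes a :: real and b n :: nat
  assumes "a > -1"
  shows "\<exists>R. finite R \<and> card R = n \<and> R \<subseteq> {0<..<1} \<and> (\<forall>x\<in>R. poly (jacobi_poly n a b) x = 0)"
  using assms
proof (induction n arbitrary: a b)
  case 0
  show ?case by (rule exI[of _ "{}"]) auto
next
  case (Suc n)
  let ?p = "jacobi_poly n (a + 1) (real (Suc b))"
  let ?q = "jacobi_poly (Suc n) a b"
  obtain R where R: "finite R" "card R = n" "R \<subseteq> {0<..<1}" "\<forall>x\<in>R. poly ?p x = 0"
    using Suc.IH[of "a + 1" "Suc b"] Suc.prems by auto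
  define g where "g x = x powr (a + 1) * (1 - x) ^ Suc b * poly ?p x" for x
  define g' where "g' x = (a + 1) * x powr a * (1 - x) ^ b * poly ?q x" for x
  have cont: "continuous_on {0..1} g"
    unfolding g_def using Suc.prems by (intro continuous_intros continuous_on_powr') auto
  have der: "(g has_real_derivative g' x) (at x)" if "0 < x" "x < 1" for x
  proof -
    have "(g has_real_derivative
       ((a + 1) * x powr a) * (1 - x) ^ Suc b * poly ?p x
       + x powr (a + 1) * (- (real (Suc b) * (1 - x) ^ b)) * poly ?p x
       + x powr (a + 1) * (1 - x) ^ Suc b * poly (pderiv ?p) x) (at x)"
      unfolding g_def using that
      by (auto intro!: derivative_eq_intros simp: algebra_simps simp del: power_Suc)
    also have "((a + 1) * x powr a) * (1 - x) ^ Suc b * poly ?p x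
       + x powr (a + 1) * (- (real (Suc b) * (1 - x) ^ b)) * poly ?p x
       + x powr (a + 1) * (1 - x) ^ Suc b * poly (pderiv ?p) x =
       x powr a * (1 - x) ^ b * (((a + 1) * (1 - x) - real (Suc b) * x) * poly ?p x
         + x * (1 - x) * poly (pderiv ?p) x)"
      using that by (simp add: powr_add algebra_simps)
    also have "((a + 1) * (1 - x) - real (Suc b) * x) * poly ?p x
         + x * (1 - x) * poly (pderiv ?p) x = (a + 1) * poly ?q x"
      using arg_cong[OF jacobi_poly_Suc[OF Suc.prems, of n "real b"], of "\<lambda>p. poly p x"]
      by (simp add: algebra_simps)
    finally show ?thesis by (simp add: g'_def mult_ac)
  qed
  have z: "g x = 0" if "x \<in> insert 0 (insert 1 R)" for x
    using that R by (auto simp: g_def)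
  \<comment> \<open>The \<open>n\<close> roots of \<open>?p\<close> and the two end points give
    \<open>n + 2\<close> zeros of \<open>g\<close>, hence \<open>n + 1\<close> zeros of
    \<open>g'\<close>; inside the open interval only the factor \<open>?q\<close> of
    \<open>g'\<close> can vanish.\<close>
  have card: "card (insert 0 (insert 1 R)) = Suc (Suc n)"
  proof -
    have "(0::real) \<notin> insert 1 R" "(1::real) \<notin> R" using R(3) by auto
    then show ?thesis using R by simp
  qed
  have fin: "finite (insert 0 (insert 1 R))" and sub: "insert 0 (insert 1 R) \<subseteq> {0..1}"
    using R by auto
  obtain Q where Q: "finite Q" "card Q = Suc n" "Q \<subseteq> {0<..<Max (insert 0 (insert 1 R))}" "\<forall>x\<in>Q. g' x = 0"
    using Rolle_finite_set[OF cont der fin card sub z] by blast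
  have "Max (insert 0 (insert 1 R)) \<le> 1"
    using fin sub Max_in[OF fin] by auto
  then have Q1: "Q \<subseteq> {0<..<1}" using Q(3) by auto
  then have "\<forall>x\<in>Q. poly ?q x = 0"
    using Q(4) Suc.prems by (fastforce simp: g'_def)
  then show ?case using Q Q1 by blast
qed

section \<open>The entire part of the Bessel function\<close>

definition bessel_coeff :: "real \<Rightarrow> nat \<Rightarrow> real" where
  "bessel_coeff \<nu> k = (-1) ^ k / (4 ^ k * fact k * pochhammer (\<nu> + 1) k)"

text \<open>The entire function with
  \<open>J\<^sub>\<nu>(x) = (x/2)\<^sup>\<nu> / \<Gamma>(\<nu> + 1) * bessel_entire \<nu> (x\<^sup>2)\<close>.\<close>
definition bessel_entire :: "real \<Rightarrow> real \<Rightarrow> real" where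
  "bessel_entire \<nu> x = (\<Sum>k. bessel_coeff \<nu> k * x ^ k)"

lemma bessel_coeff_0 [simp]: "bessel_coeff \<nu> 0 = 1"
  by (simp add: bessel_coeff_def)

lemma bessel_coeff_Suc:
  "bessel_coeff \<nu> (Suc k) = - bessel_coeff \<nu> k / (4 * (real k + 1) * (\<nu> + 1 + real k))"
  by (simp add: bessel_coeff_def pochhammer_Suc algebra_simps)

lemma pochhammer_shift:
  fixes a :: real
  shows "a * pochhammer (a + 1) k = (a + real k) * pochhammer a k"
  using pochhammer_rec[of a k] pochhammer_Suc[of a k] by (simp add: mult.commute)

text \<open>The link between the coefficients of neighbouring orders, on which both the derivative
  formula and the contiguous relation rest.\<close>

lemma bessel_coeff_lower:
  assumes "\<nu> > -1"
  shows "(\<nu> + 1) * bessel_coeff \<nu> k = (\<nu> + 1 + real k) * bessel_coeff (\<nu> + 1) k"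
proof -
  have pos: "pochhammer (\<nu> + 1) k > 0" "pochhammer (\<nu> + 1 + 1) k > 0"
    using assms by (auto intro!: pochhammer_pos)
  show ?thesis
    using pos pochhammer_shift[of "\<nu> + 1" k]
    by (simp add: bessel_coeff_def frac_eq_eq mult_ac)
qed

lemma diffs_bessel_coeff:
  assumes "\<nu> > -1"
  shows "diffs (bessel_coeff \<nu>) k = - bessel_coeff (\<nu> + 1) k / (4 * (\<nu> + 1))"
proof -
  have "diffs (bessel_coeff \<nu>) k = - bessel_coeff \<nu> k / (4 * (\<nu> + 1 + real k))"
  proof -
    have "(real k + 1) * (- bessel_coeff \<nu> k / (4 * (real k + 1) * (\<nu> + 1 + real k))) =
        - bessel_coeff \<nu> k / (4 * (\<nu> + 1 + real k))"
    proof -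
      have "4 * (real k + 1) * (\<nu> + 1 + real k) = (real k + 1) * (4 * (\<nu> + 1 + real k))" by (simp add: algebra_simps)
      moreover have "real k + 1 \<noteq> 0" by simp
      ultimately show ?thesis by (simp only: times_divide_eq_right nonzero_mult_divide_mult_cancel_left not_False_eq_True)
    qed
    then show ?thesis by (simp add: diffs_def bessel_coeff_Suc add.commute)
  qed
  also have "\<dots> = - bessel_coeff (\<nu> + 1) k / (4 * (\<nu> + 1))"
    using bessel_coeff_lower[OF assms, of k] assms by (simp add: frac_eq_eq algebra_simps)
  finally show ?thesis .
qed

lemma summable_bessel_coeff:
  assumes "\<nu> > -1"
  shows "summable (\<lambda>k. norm (bessel_coeff \<nu> k * x ^ k))"
proof -
  \<comment> \<open>For \<open>k \<ge> N\<close> one has \<open>\<bar>x\<bar> \<le> k\<close>, so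
    that the quotient of consecutive terms,
    \<open>\<bar>x\<bar> / (4 (k + 1) (\<nu> + 1 + k))\<close>, is at most
    \<open>1/4\<close>.\<close>
  define N where "N = Suc (nat \<lceil>\<bar>x\<bar>\<rceil>)"
  show ?thesis
  proof (rule summable_ratio_test[of "1/4" N])
    fix k assume k: "k \<ge> N"
    have k1: "k \<ge> 1" "\<bar>x\<bar> \<le> real k" using k by (auto simp: N_def) linarith
    have "real k \<le> (real k + 1) * (\<nu> + 1 + real k)"
      using assms k1 mult_mono[of "real k" "real k + 1" 1 "\<nu> + 1 + real k"] by simp
    then have "\<bar>x\<bar> \<le> (real k + 1) * (\<nu> + 1 + real k)" using k1 by linarith
    moreover have pos: "(real k + 1) * (\<nu> + 1 + real k) > 0" using assms by simp
    ultimately have le: "\<bar>x\<bar> / ((real k + 1) * (\<nu> + 1 + real k)) \<le> 1" by simp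
    have "norm (bessel_coeff \<nu> (Suc k) * x ^ Suc k) =
       \<bar>bessel_coeff \<nu> k * x ^ k\<bar> * (\<bar>x\<bar> / ((real k + 1) * (\<nu> + 1 + real k))) / 4"
    proof -
      have "\<nu> + 1 + real k > 0" using assms by simp
      then have "\<bar>4 * (real k + 1) * (\<nu> + 1 + real k)\<bar> = (real k + 1) * (\<nu> + 1 + real k) * 4" by simp
      then show ?thesis by (simp add: bessel_coeff_Suc abs_mult mult_ac)
    qed
    also have "\<dots> \<le> \<bar>bessel_coeff \<nu> k * x ^ k\<bar> / 4"
      using mult_left_mono[OF le, of "\<bar>bessel_coeff \<nu> k * x ^ k\<bar>"] by simp
    finally show "norm (norm (bessel_coeff \<nu> (Suc k) * x ^ Suc k)) \<le> 1/4 * norm (norm (bessel_coeff \<nu> k * x ^ k))"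
      by simp
  qed simp
qed

lemma sums_bessel_entire:
  assumes "\<nu> > -1"
  shows "(\<lambda>k. bessel_coeff \<nu> k * x ^ k) sums bessel_entire \<nu> x"
  unfolding bessel_entire_def
  using summable_norm_cancel[OF summable_bessel_coeff[OF assms]] by (rule summable_sums)

lemma sums_diffs_bessel_coeff:
  assumes "\<nu> > -1"
  shows "(\<lambda>k. diffs (bessel_coeff \<nu>) k * x ^ k) sums (- bessel_entire (\<nu> + 1) x / (4 * (\<nu> + 1)))"
  using sums_mult[OF sums_bessel_entire[of "\<nu> + 1" x], of "- 1 / (4 * (\<nu> + 1))"] assms
  by (simp add: diffs_bessel_coeff)

lemma bessel_entire_0 [simp]: "bessel_entire \<nu> 0 = 1"
  using powser_zero[of "bessel_coeff \<nu>"] by (simp add: bessel_entire_def)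

lemma has_real_derivative_bessel_entire:
  assumes "\<nu> > -1"
  shows "(bessel_entire \<nu> has_real_derivative - bessel_entire (\<nu> + 1) x / (4 * (\<nu> + 1))) (at x)"
proof -
  have "(bessel_entire \<nu> has_real_derivative (\<Sum>k. diffs (bessel_coeff \<nu>) k * x ^ k)) (at x)"
    unfolding bessel_entire_def[abs_def]
    by (intro termdiffs_strong_converges_everywhere sums_summable[OF sums_bessel_entire] assms)
  then show ?thesis
    using sums_unique[OF sums_diffs_bessel_coeff[OF assms, of x]] by simp
qed

lemma sums_index_bessel_coeff:
  assumes "\<nu> > -1"
  shows "(\<lambda>k. real k * bessel_coeff \<nu> k * x ^ k) sums (- (x * bessel_entire (\<nu> + 1) x / (4 * (\<nu> + 1))))"
proof -
  note d = sums_diffs_bessel_coeff[OF assms, of x]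
  have "(\<lambda>k. real k * bessel_coeff \<nu> k * x ^ (k - Suc 0)) sums (- bessel_entire (\<nu> + 1) x / (4 * (\<nu> + 1)))"
    using diffs_equiv[OF sums_summable[OF d]] sums_unique[OF d] by simp
  then have "(\<lambda>k. x * (real k * bessel_coeff \<nu> k * x ^ (k - Suc 0))) sums
      (x * (- bessel_entire (\<nu> + 1) x / (4 * (\<nu> + 1))))"
    by (rule sums_mult)
  moreover have "x * (real k * bessel_coeff \<nu> k * x ^ (k - Suc 0)) = real k * bessel_coeff \<nu> k * x ^ k" for k
    by (cases k) auto
  ultimately show ?thesis by simp
qed

text \<open>With \<open>x = y^2\<close>, this is the three-term recurrence \<open>J_\<nu>(y) +
  J_{\<nu>+2}(y) = (2 (\<nu> + 1) / y) J_{\<nu>+1}(y)\<close>. Coefficientwise it is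
  \<open>bessel_coeff_lower\<close>, the factor \<open>k\<close> there being produced by
  \<open>x\<close> times a derivative.\<close>

lemma bessel_entire_contiguous:
  assumes "\<nu> > -1"
  shows "(\<nu> + 1) * bessel_entire \<nu> x =
    (\<nu> + 1) * bessel_entire (\<nu> + 1) x - x * bessel_entire (\<nu> + 2) x / (4 * (\<nu> + 2))"
proof -
  have 1: "(\<lambda>k. (\<nu> + 1) * (bessel_coeff \<nu> k * x ^ k)) sums ((\<nu> + 1) * bessel_entire \<nu> x)"
    by (intro sums_mult sums_bessel_entire assms)
  have "(\<lambda>k. real k * bessel_coeff (\<nu> + 1) k * x ^ k) sums (- (x * bessel_entire (\<nu> + 2) x / (4 * (\<nu> + 2))))"
    using sums_index_bessel_coeff[of "\<nu> + 1" x] assms by (simp add: add_ac)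
  moreover have "(\<lambda>k. (\<nu> + 1) * (bessel_coeff (\<nu> + 1) k * x ^ k)) sums ((\<nu> + 1) * bessel_entire (\<nu> + 1) x)"
    using assms by (intro sums_mult sums_bessel_entire) auto
  ultimately have "(\<lambda>k. (\<nu> + 1) * (bessel_coeff (\<nu> + 1) k * x ^ k) + real k * bessel_coeff (\<nu> + 1) k * x ^ k) sums
      ((\<nu> + 1) * bessel_entire (\<nu> + 1) x + - (x * bessel_entire (\<nu> + 2) x / (4 * (\<nu> + 2))))"
    by (intro sums_add)
  moreover have "(\<nu> + 1) * (bessel_coeff (\<nu> + 1) k * x ^ k) + real k * bessel_coeff (\<nu> + 1) k * x ^ k =
      (\<nu> + 1) * (bessel_coeff \<nu> k * x ^ k)" for k
  proof -
    have "(\<nu> + 1) * (bessel_coeff (\<nu> + 1) k * x ^ k) + real k * bessel_coeff (\<nu> + 1) k * x ^ k =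
       ((\<nu> + 1 + real k) * bessel_coeff (\<nu> + 1) k) * x ^ k" by (simp add: algebra_simps)
    then show ?thesis unfolding bessel_coeff_lower[OF assms, symmetric] by simp
  qed
  ultimately show ?thesis using sums_unique2[OF 1] by simp
qed

text \<open>The constant term is 1. Since \<open>pochhammer (\<mu> + 1) k\<close> is at least
  \<open>\<mu> + 1\<close> for \<open>k \<ge> 1\<close>, the remaining terms add up to at most
  \<open>(exp \<bar>x\<bar> - 1) / (\<mu> + 1) < 1\<close> in absolute value.\<close>

lemma bessel_entire_nonzero_of_large_order:
  assumes "\<mu> \<ge> 0" "exp \<bar>x\<bar> \<le> \<mu> + 1"
  shows "bessel_entire \<mu> x \<noteq> 0"
proof
  assume "bessel_entire \<mu> x = 0"
  then have "(\<lambda>k. bessel_coeff \<mu> k * x ^ k) sums 0"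
    using sums_bessel_entire[of \<mu> x] assms by simp
  then have s: "(\<lambda>k. bessel_coeff \<mu> (Suc k) * x ^ Suc k) sums (- 1)"
    by (subst sums_Suc_iff) simp
  have "(\<lambda>k. \<bar>x\<bar> ^ k / fact k) sums exp \<bar>x\<bar>"
    using exp_converges[of "\<bar>x\<bar>"] by (simp add: field_simps)
  then have "(\<lambda>k. \<bar>x\<bar> ^ Suc k / fact (Suc k)) sums (exp \<bar>x\<bar> - 1)"
    by (subst sums_Suc_iff) simp
  then have e: "(\<lambda>k. \<bar>x\<bar> ^ Suc k / fact (Suc k) / (\<mu> + 1)) sums ((exp \<bar>x\<bar> - 1) / (\<mu> + 1))"
    by (rule sums_divide)
  have le: "norm (bessel_coeff \<mu> (Suc k) * x ^ Suc k) \<le> \<bar>x\<bar> ^ Suc k / fact (Suc k) / (\<mu> + 1)" for k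
  proof -
    have "1 \<le> pochhammer (\<mu> + 1 + 1) k"
      unfolding pochhammer_prod using assms by (intro prod_ge_1) auto
    then have p: "\<mu> + 1 \<le> pochhammer (\<mu> + 1) (Suc k)"
      using assms by (simp add: pochhammer_rec)
    have "fact (Suc k) * (\<mu> + 1) \<le> 4 ^ Suc k * fact (Suc k) * pochhammer (\<mu> + 1) (Suc k)"
      using assms p by (intro mult_mono) (auto simp del: fact_Suc power_Suc intro!: mult_nonneg_nonneg)
    moreover have p0: "pochhammer (\<mu> + 1) (Suc k) > 0" "\<mu> + 1 > 0" using p assms by linarith+
    ultimately have "\<bar>x\<bar> ^ Suc k / (4 ^ Suc k * fact (Suc k) * pochhammer (\<mu> + 1) (Suc k)) \<le>
        \<bar>x\<bar> ^ Suc k / (fact (Suc k) * (\<mu> + 1))"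
      by (intro divide_left_mono mult_pos_pos) (auto simp del: fact_Suc power_Suc)
    then show ?thesis
      using p0 by (simp add: bessel_coeff_def abs_mult power_abs del: fact_Suc power_Suc)
  qed
  have "norm (\<Sum>k. bessel_coeff \<mu> (Suc k) * x ^ Suc k) \<le> (\<Sum>k. \<bar>x\<bar> ^ Suc k / fact (Suc k) / (\<mu> + 1))"
    by (rule norm_suminf_le[OF le sums_summable[OF e]])
  then have "1 \<le> (exp \<bar>x\<bar> - 1) / (\<mu> + 1)"
    using sums_unique[OF s] sums_unique[OF e] by simp
  then show False using assms by (simp add: field_simps)
qed

text \<open>By the contiguous relation a common zero, which is not 0, would be a zero for all orders
  \<open>\<nu> + n\<close>; but a fixed point is not a zero once the order is large.\<close>

lemma bessel_entire_no_common_zero: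
  assumes "\<nu> > -1" "bessel_entire \<nu> x = 0"
  shows "bessel_entire (\<nu> + 1) x \<noteq> 0"
proof
  assume zero: "bessel_entire (\<nu> + 1) x = 0"
  have "x \<noteq> 0" using assms(2) by auto
  have all: "bessel_entire (\<nu> + real n) x = 0 \<and> bessel_entire (\<nu> + real n + 1) x = 0" for n
  proof (induction n)
    case (Suc n)
    have "x * bessel_entire (\<nu> + real n + 2) x = 0"
      using Suc bessel_entire_contiguous[of "\<nu> + real n" x] assms(1) by auto
    then show ?case using Suc \<open>x \<noteq> 0\<close> by (simp add: add_ac)
  qed (use assms zero in auto)
  obtain n :: nat where "real n \<ge> exp \<bar>x\<bar> + 1" using real_arch_simple by blast
  then have "\<nu> + real n \<ge> 0" "exp \<bar>x\<bar> \<le> \<nu> + real n + 1"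
    using assms(1) exp_gt_zero[of "\<bar>x\<bar>"] by linarith+
  then show False using bessel_entire_nonzero_of_large_order all by blast
qed

section \<open>Approximation by polynomials with positive roots\<close>

lemma poly_sums:
  fixes p :: "real poly"
  shows "(\<lambda>k. coeff p k * x ^ k) sums poly p x"
  unfolding poly_altdef by (rule sums_finite) (auto simp: coeff_eq_0)

text \<open>The scale \<open>4 m (m + \<nu> + 1)\<close>, with \<open>m = n + 1\<close> the degree, makes the linear coefficient
  exactly that of \<open>bessel_entire \<nu>\<close>.\<close>
definition bessel_approx :: "real \<Rightarrow> nat \<Rightarrow> real poly" where
  "bessel_approx \<nu> n =
     pcompose (jacobi_poly (Suc n) \<nu> 0) [:0, 1 / (4 * (real (Suc n) * (real (Suc n) + \<nu> + 1))):]"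

text \<open>The ratio between the coefficients of \<open>bessel_approx\<close> and those of the
  Bessel series. The factor at \<open>i = n + 1\<close> is zero and cuts the series off after degree
  \<open>n + 1\<close>.\<close>

definition bessel_damping :: "real \<Rightarrow> nat \<Rightarrow> nat \<Rightarrow> real" where
  "bessel_damping \<nu> n k =
     (\<Prod>i<k. 1 - real i * (\<nu> + 1 + real i) / (real (Suc n) * (real (Suc n) + \<nu> + 1)))"

lemma coeff_bessel_approx:
  assumes "\<nu> > -1"
  shows "coeff (bessel_approx \<nu> n) k = bessel_coeff \<nu> k * bessel_damping \<nu> n k"
proof -
  define m where "m = real (Suc n)"
  define N where "N = m * (m + \<nu> + 1)"
  have N: "N > 0" using assms by (simp add: N_def m_def)
  have "(-1) ^ k * pochhammer (- m) k * pochhammer (m + \<nu> + 1) k = N ^ k * bessel_damping \<nu> n k"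
  proof (induction k)
    case (Suc k)
    have "(-1) ^ Suc k * pochhammer (- m) (Suc k) * pochhammer (m + \<nu> + 1) (Suc k) =
      ((-1) ^ k * pochhammer (- m) k * pochhammer (m + \<nu> + 1) k) * ((m - k) * (m + \<nu> + 1 + k))"
      by (simp add: pochhammer_Suc algebra_simps)
    also have "(m - k) * (m + \<nu> + 1 + k) = N * (1 - real k * (\<nu> + 1 + real k) / N)"
      using N by (simp add: right_diff_distrib) (simp add: N_def algebra_simps)
    finally show ?case
      unfolding Suc.IH by (simp add: bessel_damping_def N_def m_def mult_ac)
  qed (simp add: bessel_damping_def)
  then have "pochhammer (- m) k * pochhammer (m + \<nu> + 1) k = (-1) ^ k * N ^ k * bessel_damping \<nu> n k"
    by (metis (no_types, opaque_lifting) left_minus_one_mult_self mult.assoc)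
  then have "jacobi_coeff (Suc n) \<nu> 0 k = (-1) ^ k * N ^ k * bessel_damping \<nu> n k / (pochhammer (\<nu> + 1) k * fact k)"
    by (simp add: jacobi_coeff_def m_def)
  moreover have "bessel_approx \<nu> n = pcompose (jacobi_poly (Suc n) \<nu> 0) [:0, 1 / (4 * N):]"
    by (simp only: bessel_approx_def N_def m_def)
  ultimately show ?thesis
    using N by (simp add: coeff_pcompose_linear coeff_jacobi_poly bessel_coeff_def
      power_divide power_mult_distrib)
qed

text \<open>With \<open>m = n + 1\<close> the factor at \<open>i\<close> equals
  \<open>(m - i) (m + \<nu> + 1 + i) / N\<close>, which is nonnegative for \<open>i \<le> m\<close>;
  a product reaching beyond \<open>m\<close> contains the zero factor at \<open>i = m\<close>. The
  bounds let the Bessel series dominate its approximants.\<close>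

lemma bessel_damping_bounds:
  assumes "\<nu> > -1"
  shows "0 \<le> bessel_damping \<nu> n k" "bessel_damping \<nu> n k \<le> 1"
proof -
  define m where "m = real (Suc n)"
  define N where "N = m * (m + \<nu> + 1)"
  have N: "N > 0" using assms by (simp add: N_def m_def)
  have eq: "1 - real i * (\<nu> + 1 + real i) / N = (m - i) * (m + \<nu> + 1 + i) / N" for i
    using N by (simp add: field_simps) (simp add: N_def algebra_simps)
  have "0 \<le> bessel_damping \<nu> n k \<and> bessel_damping \<nu> n k \<le> 1"
  proof (cases "k \<le> Suc (Suc n)")
    case True
    have "0 \<le> 1 - real i * (\<nu> + 1 + real i) / N \<and> 1 - real i * (\<nu> + 1 + real i) / N \<le> 1" if "i < k" for i
    proof
      show "0 \<le> 1 - real i * (\<nu> + 1 + real i) / N"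
        unfolding eq using that True assms N by (auto simp: m_def)
      show "1 - real i * (\<nu> + 1 + real i) / N \<le> 1" using N assms by simp
    qed
    then show ?thesis
      unfolding bessel_damping_def N_def m_def by (auto intro!: prod_nonneg prod_le_1)
  next
    case False
    have "1 - real (Suc n) * (\<nu> + 1 + real (Suc n)) / N = 0"
      unfolding eq by (simp add: m_def)
    then have "bessel_damping \<nu> n k = 0"
      unfolding bessel_damping_def using False
      by (intro prod_zero) (auto intro!: bexI[of _ "Suc n"] simp: N_def m_def)
    then show ?thesis by simp
  qed
  then show "0 \<le> bessel_damping \<nu> n k" "bessel_damping \<nu> n k \<le> 1" by auto
qed

lemma bessel_damping_tendsto: "(\<lambda>n. bessel_damping \<nu> n k) \<longlonglongrightarrow> 1"
proof -
  have "(\<lambda>n. 1 - real i * (\<nu> + 1 + real i) / (real (Suc n) * (real (Suc n) + \<nu> + 1))) \<longlonglongrightarrow> 1 - 0" for i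
  proof (intro tendsto_intros tendsto_divide_0[OF tendsto_const] filterlim_at_top_imp_at_infinity filterlim_at_top_mult_at_top)
    show *: "filterlim (\<lambda>n. real (Suc n)) at_top sequentially"
      by (rule filterlim_compose[OF filterlim_real_sequentially filterlim_Suc])
    show "filterlim (\<lambda>n. real (Suc n) + \<nu> + 1) at_top sequentially"
      using filterlim_tendsto_add_at_top[OF tendsto_const *, of "\<nu> + 1"] by (simp add: add_ac)
  qed
  then have "(\<lambda>n. bessel_damping \<nu> n k) \<longlonglongrightarrow> (\<Prod>i<k. 1)"
    unfolding bessel_damping_def by (intro tendsto_prod) simp
  then show ?thesis by simp
qed

lemma bessel_approx_tendsto:
  assumes "\<nu> > -1"
  shows "(\<lambda>n. poly (bessel_approx \<nu> n) x) \<longlonglongrightarrow> bessel_entire \<nu> x"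
    and "(\<lambda>n. poly (pderiv (bessel_approx \<nu> n)) x) \<longlonglongrightarrow> - bessel_entire (\<nu> + 1) x / (4 * (\<nu> + 1))"
proof -
  have le: "\<bar>bessel_damping \<nu> n k\<bar> \<le> 1" for n k
    using bessel_damping_bounds[OF assms, of n k] by simp
  \<comment> \<open>Tannery's theorem with the terms of the limit series as majorant. The index map
    \<open>h\<close> is the identity for the polynomials and \<open>Suc\<close> for their
    derivatives, whose coefficients are shifted by one.\<close>
  have 1: "(\<lambda>n. \<Sum>k. c k * bessel_damping \<nu> n (h k)) \<longlonglongrightarrow> (\<Sum>k. c k)"
    if "summable (\<lambda>k. norm (c k))" for c :: "nat \<Rightarrow> real" and h
  proof -
    have "eventually (\<lambda>(k, n). norm (c k * bessel_damping \<nu> n (h k)) \<le> norm (c k)) (at_top \<times>\<^sub>F sequentially)"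
      using le by (intro always_eventually) (auto simp: abs_mult intro!: mult_left_le)
    moreover have "(\<lambda>n. c k * bessel_damping \<nu> n (h k)) \<longlonglongrightarrow> c k" for k
      using tendsto_mult_left[OF bessel_damping_tendsto, of "c k" \<nu> "h k"] by simp
    ultimately show ?thesis
      using tannerys_theorem[of "\<lambda>k n. c k * bessel_damping \<nu> n (h k)" c sequentially "\<lambda>k. norm (c k)"] that
      by auto
  qed
  have "poly (bessel_approx \<nu> n) x = (\<Sum>k. (bessel_coeff \<nu> k * x ^ k) * bessel_damping \<nu> n k)" for n
    using sums_unique[OF poly_sums[of "bessel_approx \<nu> n" x]] coeff_bessel_approx[OF assms] by (simp add: mult_ac)
  then show "(\<lambda>n. poly (bessel_approx \<nu> n) x) \<longlonglongrightarrow> bessel_entire \<nu> x"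
    using 1[OF summable_bessel_coeff[OF assms], of x "\<lambda>k. k"] by (simp add: bessel_entire_def)
  have "coeff (pderiv (bessel_approx \<nu> n)) k = diffs (bessel_coeff \<nu>) k * bessel_damping \<nu> n (Suc k)" for n k
    by (simp add: coeff_pderiv coeff_bessel_approx[OF assms] diffs_def)
  then have eq: "poly (pderiv (bessel_approx \<nu> n)) x =
      (\<Sum>k. (diffs (bessel_coeff \<nu>) k * x ^ k) * bessel_damping \<nu> n (Suc k))" for n
    using sums_unique[OF poly_sums[of "pderiv (bessel_approx \<nu> n)" x]] by (simp add: mult_ac)
  have "summable (\<lambda>k. norm (diffs (bessel_coeff \<nu>) k * x ^ k))"
    using summable_mult[OF summable_bessel_coeff[of "\<nu> + 1" x], of "1 / (4 * (\<nu> + 1))"] assms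
    by (simp add: diffs_bessel_coeff abs_mult)
  from 1[OF this, of Suc] show "(\<lambda>n. poly (pderiv (bessel_approx \<nu> n)) x) \<longlonglongrightarrow> - bessel_entire (\<nu> + 1) x / (4 * (\<nu> + 1))"
    unfolding eq using sums_unique[OF sums_diffs_bessel_coeff[OF assms, of x]] by simp
qed

text \<open>Both sides have degree at most \<open>m\<close> and agree at the \<open>m\<close> roots
  and at 0. Normalising at 0 gives factors in the inverse roots, which stay bounded when roots
  escape to infinity.\<close>

lemma poly_eq_prod_roots:
  fixes p :: "real poly"
  assumes "finite R" "card R = m" "degree p \<le> m" "poly p 0 = 1" "\<And>x. x \<in> R \<Longrightarrow> poly p x = 0" "0 \<notin> R"
  shows "p = (\<Prod>r\<in>R. [:1, - 1 / r:])"
proof (rule poly_eqI_degree[of "insert 0 R"])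
  have "degree (\<Prod>r\<in>R. [:1, - 1 / r:]) \<le> sum (degree \<circ> (\<lambda>r. [:1, - 1 / r:])) R"
    by (rule degree_prod_sum_le[OF assms(1)])
  also have "\<dots> \<le> (\<Sum>r\<in>R. 1)" by (rule sum_mono) simp
  finally show "degree (\<Prod>r\<in>R. [:1, - 1 / r:]) < card (insert 0 R)"
    using assms by simp
  fix x assume x: "x \<in> insert 0 R"
  show "poly p x = poly (\<Prod>r\<in>R. [:1, - 1 / r:]) x"
  proof (cases "x = 0")
    case False
    then have "x \<in> R" using x by auto
    then have "(\<Prod>r\<in>R. poly [:1, - 1 / r:] x) = 0"
      using assms(1,6) by (intro prod_zero) (auto intro!: bexI[of _ x])
    then show ?thesis using \<open>x \<in> R\<close> assms(5) by (simp add: poly_prod)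
  qed (use assms in \<open>simp add: poly_prod\<close>)
qed (use assms in auto)

text \<open>Listing the roots in increasing order makes the inverse roots decrease, so that a fixed
  index \<open>j\<close> can be followed through polynomials of varying degree.\<close>

lemma prod_sorted_roots:
  fixes R :: "real set"
  assumes "finite R" "card R = Suc n" "R \<subseteq> {0<..}"
  obtains t :: "nat \<Rightarrow> real" where "\<And>j. t j \<ge> 0" "antimono t" "\<And>j. n < j \<Longrightarrow> t j = 0"
    "(\<Prod>r\<in>R. [:1, - 1 / r:]) = (\<Prod>j\<le>n. [:1, - t j:])"
proof -
  define xs where "xs = sorted_list_of_set R"
  have xs: "sorted xs" "distinct xs" "set xs = R" "length xs = Suc n"
    using assms by (auto simp: xs_def)
  define t where "t j = (if j \<le> n then 1 / xs ! j else 0)" for j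
  have pos: "xs ! j > 0" if "j \<le> n" for j
    using xs that assms(3) nth_mem[of j xs] by auto
  have "bij_betw ((!) xs) {..n} R"
    using bij_betw_nth[OF xs(2) refl, of R] xs by (simp add: lessThan_Suc_atMost)
  then have "(\<Prod>r\<in>R. [:1, - 1 / r:]) = (\<Prod>j\<le>n. [:1, - 1 / xs ! j:])"
    by (rule prod.reindex_bij_betw[symmetric])
  also have "\<dots> = (\<Prod>j\<le>n. [:1, - t j:])"
    by (intro prod.cong) (auto simp: t_def)
  finally have 4: "(\<Prod>r\<in>R. [:1, - 1 / r:]) = (\<Prod>j\<le>n. [:1, - t j:])" .
  have "antimono t"
  proof
    fix i j :: nat assume "i \<le> j"
    then show "t j \<le> t i"
      using pos[of i] pos[of j] sorted_nth_mono[OF xs(1) \<open>i \<le> j\<close>] xs(4) by (auto simp: t_def frac_le)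
  qed
  moreover have "t j \<ge> 0" for j using pos[of j] by (auto simp: t_def)
  ultimately show ?thesis using that[of t] 4 by (auto simp: t_def)
qed

lemma bessel_approx_factorization:
  assumes "\<nu> > -1"
  obtains t :: "nat \<Rightarrow> nat \<Rightarrow> real" where "\<And>n j. t n j \<ge> 0" "\<And>n. antimono (t n)" "\<And>n j. n < j \<Longrightarrow> t n j = 0"
    "\<And>n. bessel_approx \<nu> n = (\<Prod>j\<le>n. [:1, - t n j:])"
proof -
  have "\<exists>t. (\<forall>j. t j \<ge> 0) \<and> antimono t \<and> (\<forall>j>n. t j = 0) \<and> bessel_approx \<nu> n = (\<Prod>j\<le>n. [:1, - t j:])" for n
  proof -
    define N where "N = 4 * (real (Suc n) * (real (Suc n) + \<nu> + 1))"
    have N: "N > 0" using assms by (simp add: N_def)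
    obtain R where R: "finite R" "card R = Suc n" "R \<subseteq> {0<..<1}" "\<forall>x\<in>R. poly (jacobi_poly (Suc n) \<nu> (real 0)) x = 0"
      using jacobi_poly_roots[OF assms] by blast
    define R' where "R' = (\<lambda>x. N * x) ` R"
    have R': "finite R'" "card R' = Suc n" "R' \<subseteq> {0<..}"
      using R N by (auto simp: R'_def card_image inj_on_def)
    have z: "poly (bessel_approx \<nu> n) x = 0" if "x \<in> R'" for x
    proof -
      have "bessel_approx \<nu> n = pcompose (jacobi_poly (Suc n) \<nu> 0) [:0, 1 / N:]"
        by (simp only: bessel_approx_def N_def)
      then show ?thesis using that R N by (auto simp: R'_def poly_pcompose)
    qed
    have 0: "poly (bessel_approx \<nu> n) 0 = 1"
      by (simp add: bessel_approx_def poly_pcompose)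
    have "degree (bessel_approx \<nu> n) \<le> Suc n"
      unfolding bessel_approx_def
      using degree_jacobi_poly[of "Suc n" \<nu> 0] by (simp add: degree_pcompose)
    then have "bessel_approx \<nu> n = (\<Prod>r\<in>R'. [:1, - 1 / r:])"
      using poly_eq_prod_roots[OF R'(1,2) _ 0 z] R'(3) by auto
    moreover obtain t :: "nat \<Rightarrow> real" where "\<And>j. t j \<ge> 0" "antimono t" "\<And>j. n < j \<Longrightarrow> t j = 0"
      "(\<Prod>r\<in>R'. [:1, - 1 / r:]) = (\<Prod>j\<le>n. [:1, - t j:])"
      using prod_sorted_roots[OF R'] by blast
    ultimately show ?thesis by (intro exI[of _ t]) simp
  qed
  then obtain t where "\<And>n. (\<forall>j. t n j \<ge> 0) \<and> antimono (t n) \<and> (\<forall>j>n. t n j = 0) \<and> bessel_approx \<nu> n = (\<Prod>j\<le>n. [:1, - t n j:])"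
    by metis
  then show ?thesis by (intro that[of t]) auto
qed

lemma poly_pderiv_prod_linear:
  fixes t :: "nat \<Rightarrow> real"
  shows "poly (pderiv (\<Prod>j\<in>A. [:1, - t j:])) x = - (\<Sum>j\<in>A. t j * (\<Prod>i\<in>A - {j}. 1 - x * t i))"
  by (simp add: pderiv_prod poly_sum poly_prod sum_negf[symmetric] pderiv_pCons mult_ac)

section \<open>Limits of polynomials with positive roots\<close>

text \<open>Bolzano-Weierstrass for one \<open>j\<close> after another, then a diagonal choice:
  after the first \<open>j + 1\<close> terms, the diagonal sequence is a subsequence of one along
  which coordinate \<open>j\<close> converges.\<close>

lemma diagonal_convergent_subsequence:
  fixes t :: "nat \<Rightarrow> nat \<Rightarrow> real"
  assumes "\<And>j. bounded (range (\<lambda>n. t n j))"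
  shows "\<exists>r \<tau>. strict_mono (r :: nat \<Rightarrow> nat) \<and> (\<forall>j. (\<lambda>n. t (r n) j) \<longlonglongrightarrow> \<tau> j)"
proof -
  interpret subseqs "\<lambda>j r. convergent (\<lambda>n. t (r n) j)"
  proof
    fix j and s :: "nat \<Rightarrow> nat"
    have "bounded (range (\<lambda>n. t (s n) j))"
      using assms[of j] by (rule bounded_subset) auto
    then obtain l r where "strict_mono r" "((\<lambda>n. t (s n) j) \<circ> r) \<longlonglongrightarrow> l"
      using bounded_imp_convergent_subsequence by blast
    then show "\<exists>r'. strict_mono r' \<and> convergent (\<lambda>n. t ((s \<circ> r') n) j)"
      by (auto simp: convergent_def o_def)
  qed
  have "convergent (\<lambda>n. t (diagseq n) j)" for j
  proof -
    have "convergent (\<lambda>n. t ((diagseq \<circ> ((+) (Suc j))) n) j)"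
    proof (rule diagseq_holds)
      fix r s :: "nat \<Rightarrow> nat" and n
      assume "strict_mono r" "convergent (\<lambda>m. t (s m) n)"
      then show "convergent (\<lambda>m. t ((s \<circ> r) m) n)"
        using convergent_subseq_convergent[of "\<lambda>m. t (s m) n" r] by (simp add: o_def)
    qed
    then have "convergent (\<lambda>n. t (diagseq (n + Suc j)) j)"
      by (simp add: o_def add.commute)
    then show ?thesis by (subst (asm) convergent_ignore_initial_segment)
  qed
  then have "(\<lambda>n. t (diagseq n) j) \<longlonglongrightarrow> lim (\<lambda>n. t (diagseq n) j)" for j
    by (simp add: convergent_LIMSEQ_iff)
  then show ?thesis
    by (intro exI[of _ diagseq] exI[of _ "\<lambda>j. lim (\<lambda>n. t (diagseq n) j)"] conjI allI subseq_diagseq)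
qed

text \<open>The \<open>t n j\<close> are the inverse roots of the \<open>n\<close>-th polynomial, padded with zeros. The bound
  \<open>t n j \<le> s / (j + 1)\<close> that follows from their constant sum is what allows passing to the limit
  in the logarithmic derivatives after the linear terms have been split off.\<close>
locale positive_roots_limit =
  fixes t :: "nat \<Rightarrow> nat \<Rightarrow> real" and N :: "nat \<Rightarrow> nat" and \<tau> :: "nat \<Rightarrow> real" and s :: real
    and f f' :: "real \<Rightarrow> real"
  assumes nonneg: "t n j \<ge> 0"
    and antimono: "antimono (t n)"
    and support: "N n < j \<Longrightarrow> t n j = 0"
    and sum_eq: "(\<Sum>j\<le>N n. t n j) = s"
    and t_tendsto: "(\<lambda>n. t n j) \<longlonglongrightarrow> \<tau> j"
    and prod_tendsto: "(\<lambda>n. \<Prod>j\<le>N n. 1 - x * t n j) \<longlonglongrightarrow> f x"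
    and deriv_tendsto: "(\<lambda>n. - (\<Sum>j\<le>N n. t n j * (\<Prod>i\<in>{..N n} - {j}. 1 - x * t n i))) \<longlonglongrightarrow> f' x"
    and no_common_zero: "f x = 0 \<Longrightarrow> f' x \<noteq> 0"
begin

lemma sum_lessThan_le: "(\<Sum>j<m. t n j) \<le> s"
proof -
  have "(\<Sum>j<m. t n j) = (\<Sum>j\<in>{..<m} \<inter> {..N n}. t n j)"
    by (rule sum.mono_neutral_right) (auto simp: not_le[symmetric] intro: support)
  also have "\<dots> \<le> (\<Sum>j\<le>N n. t n j)"
    by (rule sum_mono2) (auto simp: nonneg)
  finally show ?thesis by (simp add: sum_eq)
qed

lemma t_le: "t n j \<le> s / (real j + 1)"
proof -
  have "(\<Sum>i<Suc j. t n j) \<le> (\<Sum>i<Suc j. t n i)"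
    by (intro sum_mono antimonoD[OF antimono]) auto
  then have "(real j + 1) * t n j \<le> s"
    using sum_lessThan_le[of n "Suc j"] by (simp add: add.commute)
  then show ?thesis by (simp add: field_simps)
qed

lemma tau_nonneg: "\<tau> j \<ge> 0"
  by (rule LIMSEQ_le_const[OF t_tendsto]) (auto simp: nonneg)

lemma tau_antimono: "antimono \<tau>"
  by (intro antimonoI LIMSEQ_le[OF t_tendsto t_tendsto] exI[of _ 0] allI impI antimonoD[OF antimono])

text \<open>In general only an inequality survives the limit, because part of the constant sum may
  escape to ever larger indices. For Bessel functions equality is proved separately.\<close>

lemma tau_summable: "summable \<tau>" and suminf_tau_le: "suminf \<tau> \<le> s"
proof -
  have le: "(\<Sum>j<m. \<tau> j) \<le> s" for m
    using sum_lessThan_le by (intro LIMSEQ_le_const2[OF tendsto_sum[OF t_tendsto]]) auto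
  show "summable \<tau>"
    by (rule bounded_imp_summable[of \<tau> s]) (simp_all only: tau_nonneg le lessThan_Suc_atMost[symmetric])
  then show "suminf \<tau> \<le> s"
    using le suminf_le_const by blast
qed

text \<open>From \<open>\<bar>1 - u\<bar> \<le> exp \<bar>u\<bar>\<close> and the constant sum
  \<open>s\<close>; the bound is uniform in \<open>n\<close> and in the set of factors kept.\<close>

lemma abs_prod_le:
  assumes "A \<subseteq> {..N n}"
  shows "\<bar>\<Prod>i\<in>A. 1 - x * t n i\<bar> \<le> exp (\<bar>x\<bar> * s)"
proof -
  have fin: "finite A" using assms finite_subset by blast
  have "\<bar>\<Prod>i\<in>A. 1 - x * t n i\<bar> = (\<Prod>i\<in>A. \<bar>1 - x * t n i\<bar>)" by (rule abs_prod)
  also have "\<dots> \<le> (\<Prod>i\<in>A. exp (\<bar>x\<bar> * t n i))"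
  proof (rule prod_mono, safe)
    fix i
    have "\<bar>1 - x * t n i\<bar> \<le> 1 + \<bar>x\<bar> * t n i"
      using nonneg[of n i] abs_triangle_ineq4[of 1 "x * t n i"] by (simp add: abs_mult)
    also have "\<dots> \<le> exp (\<bar>x\<bar> * t n i)" by (rule exp_ge_add_one_self)
    finally show "\<bar>1 - x * t n i\<bar> \<le> exp (\<bar>x\<bar> * t n i)" .
  qed simp
  also have "\<dots> = exp (\<bar>x\<bar> * (\<Sum>i\<in>A. t n i))"
    using fin by (simp add: exp_sum sum_distrib_left)
  also have "(\<Sum>i\<in>A. t n i) \<le> s"
    using sum_mono2[of "{..N n}" A "t n"] assms nonneg by (simp add: sum_eq)
  finally show ?thesis by (simp add: mult_left_mono)
qed

text \<open>Extracts the factor at \<open>j\<close>, which later tends to 0. If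
  \<open>N n < j\<close>, that factor is 1 by the padding and nothing has to be removed.\<close>

lemma abs_prod_le_factor:
  assumes "A \<subseteq> {..N n}" "j \<in> A \<or> N n < j"
  shows "\<bar>\<Prod>i\<in>A. 1 - x * t n i\<bar> \<le> \<bar>1 - x * t n j\<bar> * exp (\<bar>x\<bar> * s)"
proof -
  have fin: "finite A" using assms finite_subset by blast
  have "(\<Prod>i\<in>A. 1 - x * t n i) = (1 - x * t n j) * (\<Prod>i\<in>A - {j}. 1 - x * t n i)"
  proof (cases "j \<in> A")
    case True
    then show ?thesis using fin by (simp add: prod.remove)
  next
    case False
    then show ?thesis using assms(2) by (simp add: support)
  qed
  then show ?thesis
    using abs_prod_le[of "A - {j}" n x] assms(1) by (auto simp: abs_mult intro!: mult_left_mono)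
qed

lemma factor_tendsto_0:
  assumes "x * \<tau> j = 1"
  shows "(\<lambda>n. \<bar>1 - x * t n j\<bar>) \<longlonglongrightarrow> 0"
proof -
  have "(\<lambda>n. \<bar>1 - x * t n j\<bar>) \<longlonglongrightarrow> \<bar>1 - x * \<tau> j\<bar>"
    by (intro tendsto_intros t_tendsto)
  then show ?thesis by (simp add: assms)
qed

lemma limit_zero_if:
  assumes "x * \<tau> j = 1"
  shows "f x = 0"
proof -
  have "(\<lambda>n. \<Prod>j\<le>N n. 1 - x * t n j) \<longlonglongrightarrow> 0"
  proof (rule Lim_null_comparison)
    show "(\<lambda>n. \<bar>1 - x * t n j\<bar> * exp (\<bar>x\<bar> * s)) \<longlonglongrightarrow> 0"
      using tendsto_mult_right[OF factor_tendsto_0[OF assms], of "exp (\<bar>x\<bar> * s)"] by simp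
    show "\<forall>\<^sub>F n in sequentially. norm (\<Prod>j\<le>N n. 1 - x * t n j) \<le> \<bar>1 - x * t n j\<bar> * exp (\<bar>x\<bar> * s)"
      by (intro always_eventually allI) (auto simp: not_le intro!: abs_prod_le_factor)
  qed
  then show ?thesis using prod_tendsto LIMSEQ_unique by blast
qed

text \<open>Each summand of the derivative omits a single factor, so it keeps the one at
  \<open>j\<close> or the one at \<open>k\<close>. Both tend to 0, which would make \<open>x\<close>
  a common zero of \<open>f\<close> and \<open>f'\<close>.\<close>

lemma limit_zeros_simple:
  assumes "x * \<tau> j = 1" "x * \<tau> k = 1"
  shows "j = k"
proof (rule ccontr)
  assume "j \<noteq> k"
  have "(\<lambda>n. - (\<Sum>j\<le>N n. t n j * (\<Prod>i\<in>{..N n} - {j}. 1 - x * t n i))) \<longlonglongrightarrow> 0"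
  proof (rule Lim_null_comparison)
    show "(\<lambda>n. s * ((\<bar>1 - x * t n j\<bar> + \<bar>1 - x * t n k\<bar>) * exp (\<bar>x\<bar> * s))) \<longlonglongrightarrow> 0"
      using tendsto_mult_left[OF tendsto_mult_right[OF tendsto_add[OF factor_tendsto_0[OF assms(1)]
              factor_tendsto_0[OF assms(2)]], of "exp (\<bar>x\<bar> * s)"], of s] by simp
    have "norm (- (\<Sum>l\<le>N n. t n l * (\<Prod>i\<in>{..N n} - {l}. 1 - x * t n i))) \<le>
       s * ((\<bar>1 - x * t n j\<bar> + \<bar>1 - x * t n k\<bar>) * exp (\<bar>x\<bar> * s))" for n
    proof -
      have le: "\<bar>\<Prod>i\<in>{..N n} - {l}. 1 - x * t n i\<bar> \<le> (\<bar>1 - x * t n j\<bar> + \<bar>1 - x * t n k\<bar>) * exp (\<bar>x\<bar> * s)" for l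
      proof -
        consider "l \<noteq> j" | "l \<noteq> k" using \<open>j \<noteq> k\<close> by auto
        then obtain m where m: "m = j \<or> m = k" "l \<noteq> m" by metis
        have "\<bar>\<Prod>i\<in>{..N n} - {l}. 1 - x * t n i\<bar> \<le> \<bar>1 - x * t n m\<bar> * exp (\<bar>x\<bar> * s)"
          using m by (intro abs_prod_le_factor) auto
        also have "\<dots> \<le> (\<bar>1 - x * t n j\<bar> + \<bar>1 - x * t n k\<bar>) * exp (\<bar>x\<bar> * s)"
          using m by (intro mult_right_mono) auto
        finally show ?thesis .
      qed
      have "norm (- (\<Sum>l\<le>N n. t n l * (\<Prod>i\<in>{..N n} - {l}. 1 - x * t n i))) \<le>
         (\<Sum>l\<le>N n. t n l * \<bar>\<Prod>i\<in>{..N n} - {l}. 1 - x * t n i\<bar>)"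
        unfolding norm_minus_cancel
        by (rule order_trans[OF norm_sum]) (auto simp: abs_mult nonneg intro!: sum_mono)
      also have "\<dots> \<le> (\<Sum>l\<le>N n. t n l * ((\<bar>1 - x * t n j\<bar> + \<bar>1 - x * t n k\<bar>) * exp (\<bar>x\<bar> * s)))"
        by (intro sum_mono mult_left_mono le nonneg)
      also have "\<dots> = s * ((\<bar>1 - x * t n j\<bar> + \<bar>1 - x * t n k\<bar>) * exp (\<bar>x\<bar> * s))"
        by (simp add: sum_distrib_right[symmetric] sum_eq)
      finally show ?thesis .
    qed
    then show "\<forall>\<^sub>F n in sequentially. norm (- (\<Sum>l\<le>N n. t n l * (\<Prod>i\<in>{..N n} - {l}. 1 - x * t n i))) \<le>
       s * ((\<bar>1 - x * t n j\<bar> + \<bar>1 - x * t n k\<bar>) * exp (\<bar>x\<bar> * s))"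
      by (rule always_eventually[OF allI])
  qed
  then have "f' x = 0" using deriv_tendsto LIMSEQ_unique by blast
  then show False using no_common_zero limit_zero_if[OF assms(1)] by blast
qed

lemma abs_x_t_le_half:
  assumes "2 * (\<bar>x\<bar> * s) \<le> real j + 1"
  shows "\<bar>x * t n j\<bar> \<le> 1 / 2"
proof -
  have "\<bar>x * t n j\<bar> \<le> \<bar>x\<bar> * (s / (real j + 1))"
    unfolding abs_mult using t_le[of n j] nonneg[of n j] by (intro mult_left_mono) auto
  also have "\<dots> \<le> 1 / 2" using assms by (simp add: field_simps)
  finally show ?thesis .
qed

text \<open>In \<open>t / (1 - x t) = t + x t^2 / (1 - x t)\<close> the linear parts add up to
  exactly \<open>s\<close> for every \<open>n\<close>, while the quadratic ones are eventually
  dominated by a multiple of \<open>1 / (j + 1)^2\<close>, so that Tannery's theorem applies to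
  them.\<close>

lemma log_deriv_series:
  assumes "\<And>j. x * \<tau> j \<noteq> 1"
  shows "f' x = - f x * (s + (\<Sum>j. x * (\<tau> j)\<^sup>2 / (1 - x * \<tau> j)))"
    and "summable (\<lambda>j. x * (\<tau> j)\<^sup>2 / (1 - x * \<tau> j))"
proof -
  \<comment> \<open>From index \<open>J\<close> on, \<open>t_le\<close> gives
    \<open>\<bar>x * t n j\<bar> \<le> 1/2\<close> for all \<open>n\<close>, so the denominators are
    at least \<open>1/2\<close>. The finitely many smaller indices are nonsingular for large
    \<open>n\<close> because their limits are.\<close>
  obtain J :: nat where J: "2 * (\<bar>x\<bar> * s) \<le> real J" using real_arch_simple by blast
  define a where "a j n = x * (t n j)\<^sup>2 / (1 - x * t n j)" for j n
  have half: "\<bar>x * t n j\<bar> \<le> 1 / 2" if "j \<ge> J" for n j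
    using that J by (intro abs_x_t_le_half) linarith
  have bound: "norm (a j n) \<le> 2 * \<bar>x\<bar> * s\<^sup>2 * (1 / real (Suc j) ^ 2)" if "j \<ge> J" for j n
  proof -
    have h: "1 / 2 \<le> 1 - x * t n j" using half[OF that, of n] by linarith
    have "norm (a j n) = \<bar>x\<bar> * (t n j)\<^sup>2 / (1 - x * t n j)" using h by (simp add: a_def abs_mult)
    also have "\<dots> \<le> \<bar>x\<bar> * (t n j)\<^sup>2 / (1 / 2)" using h by (intro divide_left_mono) auto
    also have "\<dots> \<le> 2 * \<bar>x\<bar> * (s / (real j + 1))\<^sup>2"
      using power_mono[OF t_le nonneg, of n j 2] by (simp add: mult_left_mono)
    finally show ?thesis by (simp add: power_divide add.commute)
  qed
  have "\<forall>\<^sub>F (j, n) in sequentially \<times>\<^sub>F (sequentially :: nat filter). J \<le> j"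
    by (subst eventually_prod1) (auto simp: eventually_ge_at_top)
  then have "eventually (\<lambda>(j, n). norm (a j n) \<le> 2 * \<bar>x\<bar> * s\<^sup>2 * (1 / real (Suc j) ^ 2)) (at_top \<times>\<^sub>F sequentially)"
    by (rule eventually_mono) (use bound in auto)
  moreover have "(\<lambda>n. a j n) \<longlonglongrightarrow> x * (\<tau> j)\<^sup>2 / (1 - x * \<tau> j)" for j
    unfolding a_def using assms[of j] by (intro tendsto_intros t_tendsto) auto
  moreover have "summable (\<lambda>j. 2 * \<bar>x\<bar> * s\<^sup>2 * (1 / real (Suc j) ^ 2))"
  proof (rule summable_mult)
    have "summable (\<lambda>n. inverse (real n ^ 2))"
      using inverse_power_summable[of 2, where 'a = real] by simp
    then show "summable (\<lambda>j. 1 / real (Suc j) ^ 2)"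
      by (subst (asm) summable_Suc_iff[symmetric]) (simp add: inverse_eq_divide)
  qed
  ultimately have T: "summable (\<lambda>j. norm (x * (\<tau> j)\<^sup>2 / (1 - x * \<tau> j)))"
      "(\<lambda>n. \<Sum>j. a j n) \<longlonglongrightarrow> (\<Sum>j. x * (\<tau> j)\<^sup>2 / (1 - x * \<tau> j))"
    using tannerys_theorem[of a "\<lambda>j. x * (\<tau> j)\<^sup>2 / (1 - x * \<tau> j)" sequentially "\<lambda>j. 2 * \<bar>x\<bar> * s\<^sup>2 * (1 / real (Suc j) ^ 2)"]
    by auto
  show "summable (\<lambda>j. x * (\<tau> j)\<^sup>2 / (1 - x * \<tau> j))"
    using T(1) by (rule summable_norm_cancel)
  have "eventually (\<lambda>n. \<forall>j\<in>{..<J}. 1 - x * t n j \<noteq> 0) sequentially"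
  proof (rule eventually_ball_finite, simp, safe)
    fix j
    have "(\<lambda>n. 1 - x * t n j) \<longlonglongrightarrow> 1 - x * \<tau> j" by (intro tendsto_intros t_tendsto)
    then show "eventually (\<lambda>n. 1 - x * t n j \<noteq> 0) sequentially"
      by (rule tendsto_imp_eventually_ne) (use assms[of j] in auto)
  qed
  then have "eventually (\<lambda>n. - (\<Sum>j\<le>N n. t n j * (\<Prod>i\<in>{..N n} - {j}. 1 - x * t n i)) =
     - (\<Prod>j\<le>N n. 1 - x * t n j) * (s + (\<Sum>j. a j n))) sequentially"
  proof eventually_elim
    case (elim n)
    have ne: "1 - x * t n j \<noteq> 0" for j
      using elim half[of j n] by (cases "j < J") (auto simp: not_less)
    have "(\<Sum>j. a j n) = (\<Sum>j\<le>N n. a j n)"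
      by (rule suminf_finite) (auto simp: a_def support not_le)
    then have "s + (\<Sum>j. a j n) = (\<Sum>j\<le>N n. t n j + a j n)"
      by (simp add: sum.distrib sum_eq)
    also have "\<dots> = (\<Sum>j\<le>N n. t n j / (1 - x * t n j))"
      using ne by (intro sum.cong) (auto simp: a_def field_simps power2_eq_square)
    finally have "(\<Prod>j\<le>N n. 1 - x * t n j) * (s + (\<Sum>j. a j n)) =
        (\<Sum>j\<le>N n. t n j * ((\<Prod>i\<le>N n. 1 - x * t n i) / (1 - x * t n j)))"
      by (simp add: sum_distrib_left mult_ac)
    also have "\<dots> = (\<Sum>j\<le>N n. t n j * (\<Prod>i\<in>{..N n} - {j}. 1 - x * t n i))"
      using ne by (intro sum.cong refl) (simp add: prod_diff1)
    finally show ?case by simp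
  qed
  moreover have "(\<lambda>n. - (\<Prod>j\<le>N n. 1 - x * t n j) * (s + (\<Sum>j. a j n))) \<longlonglongrightarrow>
      - f x * (s + (\<Sum>j. x * (\<tau> j)\<^sup>2 / (1 - x * \<tau> j)))"
    by (intro tendsto_intros prod_tendsto T)
  ultimately have "(\<lambda>n. - (\<Sum>j\<le>N n. t n j * (\<Prod>i\<in>{..N n} - {j}. 1 - x * t n i))) \<longlonglongrightarrow>
      - f x * (s + (\<Sum>j. x * (\<tau> j)\<^sup>2 / (1 - x * \<tau> j)))"
    using tendsto_cong by fastforce
  then show "f' x = - f x * (s + (\<Sum>j. x * (\<tau> j)\<^sup>2 / (1 - x * \<tau> j)))"
    using deriv_tendsto LIMSEQ_unique by blast
qed

text \<open>If no limit factor vanished, \<open>log_deriv_series\<close> would make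
  \<open>f' x\<close> a multiple of \<open>f x\<close>, and a zero of \<open>f\<close> would be a
  common one.\<close>

lemma limit_zero_iff: "f x = 0 \<longleftrightarrow> (\<exists>j. x * \<tau> j = 1)"
proof
  assume "f x = 0"
  then show "\<exists>j. x * \<tau> j = 1"
    using log_deriv_series(1)[of x] no_common_zero[of x] by auto
qed (auto intro: limit_zero_if)

lemma tau_Suc_less:
  assumes "\<tau> j > 0"
  shows "\<tau> (Suc j) < \<tau> j"
proof -
  have "\<tau> (Suc j) \<noteq> \<tau> j"
    using limit_zeros_simple[of "1 / \<tau> j" j "Suc j"] assms by auto
  then show ?thesis using antimonoD[OF tau_antimono, of j "Suc j"] by simp
qed

end

section \<open>Partial fractions over the zeros\<close>

text \<open>The terms beyond \<open>K\<close> are nonnegative, and \<open>y\<close> is taken so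
  large that \<open>d K * y ^ K\<close> exceeds the bound \<open>C * y ^ (K - 1)\<close> on the
  terms below \<open>K\<close>.\<close>

lemma power_series_pos_somewhere:
  fixes d :: "nat \<Rightarrow> real"
  assumes "\<And>k. k \<ge> K \<Longrightarrow> d k \<ge> 0" "d K > 0" "K \<ge> 1" "\<And>y. summable (\<lambda>k. d k * y ^ k)"
  shows "\<exists>y\<ge>1. 0 < (\<Sum>k. d k * y ^ k)"
proof -
  define C where "C = (\<Sum>k<K. \<bar>d k\<bar>)"
  define y where "y = max 1 ((C + 1) / d K)"
  have y: "y \<ge> 1" "d K * y \<ge> C + 1"
    using assms(2) by (auto simp: y_def max_def field_simps)
  have pow: "y ^ K = y * y ^ (K - 1)" using assms(3) by (cases K) auto
  have "\<bar>\<Sum>k<K. d k * y ^ k\<bar> \<le> (\<Sum>k<K. \<bar>d k\<bar> * y ^ (K - 1))"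
    using y(1) by (intro order_trans[OF sum_abs] sum_mono) (auto simp: abs_mult intro!: mult_left_mono power_increasing)
  then have 1: "\<bar>\<Sum>k<K. d k * y ^ k\<bar> \<le> C * y ^ (K - 1)"
    by (simp add: C_def sum_distrib_right)
  have sum: "summable (\<lambda>k. d (k + K) * y ^ (k + K))"
    using assms(4)[of y] by (subst summable_iff_shift)
  have "(\<Sum>k<1. d (k + K) * y ^ (k + K)) \<le> (\<Sum>k. d (k + K) * y ^ (k + K))"
    using y(1) assms(1) by (intro sum_le_suminf sum) auto
  then have 2: "d K * y ^ K \<le> (\<Sum>k. d (k + K) * y ^ (k + K))" by simp
  have "(C + 1) * y ^ (K - 1) \<le> d K * y ^ K"
    using mult_right_mono[OF y(2), of "y ^ (K - 1)"] y(1) by (simp add: pow)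
  moreover have "y ^ (K - 1) > 0" using y(1) by simp
  moreover have "(\<Sum>k. d k * y ^ k) = (\<Sum>k. d (k + K) * y ^ (k + K)) + (\<Sum>k<K. d k * y ^ k)"
    by (rule suminf_split_initial_segment[OF assms(4)])
  ultimately have "0 < (\<Sum>k. d k * y ^ k)" using 1 2 by (simp add: algebra_simps)
  then show ?thesis using y(1) by blast
qed

lemma bessel_coeff_neg_power_pos:
  assumes "\<nu> > -1"
  shows "bessel_coeff \<nu> k * (- 1) ^ k > 0"
proof -
  have "pochhammer (\<nu> + 1) k > 0" using assms by (intro pochhammer_pos) simp
  then show ?thesis by (simp add: bessel_coeff_def flip: power_mult_distrib)
qed

lemma bessel_coeff_neg_power:
  "bessel_coeff \<nu> k * (- y) ^ k = (bessel_coeff \<nu> k * (- 1) ^ k) * y ^ k"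
  by (simp add: power_minus[of y])

lemma bessel_entire_neg_pos:
  assumes "\<nu> > -1" "y \<ge> 0"
  shows "bessel_entire \<nu> (- y) > 0"
proof -
  note s = sums_bessel_entire[OF assms(1), of "- y"]
  have "(\<Sum>k<1. bessel_coeff \<nu> k * (- y) ^ k) \<le> bessel_entire \<nu> (- y)"
    unfolding sums_unique[OF s]
  proof (rule sum_le_suminf[OF sums_summable[OF s]])
    fix k
    show "0 \<le> bessel_coeff \<nu> k * (- y) ^ k"
      by (subst bessel_coeff_neg_power) (use bessel_coeff_neg_power_pos[OF assms(1), of k] assms(2) in \<open>auto intro!: mult_nonneg_nonneg\<close>)
  qed simp
  then show ?thesis by simp
qed

text \<open>On the negative axis the logarithmic derivative tends to \<open>0\<close>, but not faster than \<open>m / y\<close> for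
  any \<open>m\<close>; this excludes an exponential factor and a finite number of zeros, respectively.\<close>
lemma bessel_entire_neg_log_deriv_small:
  assumes "\<nu> > -1" "a > 0"
  shows "\<exists>y\<ge>1. bessel_entire (\<nu> + 1) (- y) / (4 * (\<nu> + 1)) < a * bessel_entire \<nu> (- y)"
proof -
  define c where "c k = bessel_coeff \<nu> k * (- 1) ^ k" for k
  have c: "c k > 0" for k using bessel_coeff_neg_power_pos[OF assms(1)] by (simp add: c_def)
  obtain K :: nat where K: "1 / a \<le> real K" using real_arch_simple by blast
  \<comment> \<open>The coefficients in \<open>y\<close> of the difference of the two sides; they
    are positive as soon as \<open>4 (\<nu> + 1 + k) > 1 / a\<close>.\<close>
  define d where "d k = c k * (a - 1 / (4 * (\<nu> + 1 + real k)))" for k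
  have "(\<lambda>k. a * (bessel_coeff \<nu> k * (- y) ^ k) - bessel_coeff (\<nu> + 1) k * (- y) ^ k / (4 * (\<nu> + 1)))
      sums (a * bessel_entire \<nu> (- y) - bessel_entire (\<nu> + 1) (- y) / (4 * (\<nu> + 1)))" for y
    using assms(1) by (intro sums_diff sums_mult sums_divide sums_bessel_entire) auto
  moreover have "a * (bessel_coeff \<nu> k * (- y) ^ k) - bessel_coeff (\<nu> + 1) k * (- y) ^ k / (4 * (\<nu> + 1)) = d k * y ^ k"
    for k y
  proof -
    have "bessel_coeff (\<nu> + 1) k / (4 * (\<nu> + 1)) = bessel_coeff \<nu> k / (4 * (\<nu> + 1 + real k))"
      using bessel_coeff_lower[OF assms(1), of k] assms(1) by (simp add: frac_eq_eq algebra_simps)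
    then have "bessel_coeff (\<nu> + 1) k * (- y) ^ k / (4 * (\<nu> + 1)) = bessel_coeff \<nu> k / (4 * (\<nu> + 1 + real k)) * (- y) ^ k"
      by (metis times_divide_eq_left)
    also have "\<dots> = c k * y ^ k / (4 * (\<nu> + 1 + real k))"
      using bessel_coeff_neg_power[of \<nu> k y] by (simp add: c_def)
    finally show ?thesis
      using bessel_coeff_neg_power[of \<nu> k y] by (simp add: d_def c_def algebra_simps)
  qed
  ultimately have sums: "(\<lambda>k. d k * y ^ k) sums (a * bessel_entire \<nu> (- y) - bessel_entire (\<nu> + 1) (- y) / (4 * (\<nu> + 1)))" for y
    by simp
  have pos: "d k > 0" if "k \<ge> Suc K" for k
  proof -
    have "real K + 1 \<le> real k" using that by simp
    then have "1 / a < 4 * (\<nu> + 1 + real k)" using K assms(1) by (smt (verit) of_nat_0_le_iff)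
    then have "1 / (4 * (\<nu> + 1 + real k)) < a" using assms by (simp add: field_simps)
    then show ?thesis using c by (simp add: d_def)
  qed
  obtain y where "y \<ge> 1" "0 < (\<Sum>k. d k * y ^ k)"
    using power_series_pos_somewhere[of "Suc K" d, OF less_imp_le[OF pos] pos _ sums_summable[OF sums]] by auto
  then show ?thesis using sums_unique[OF sums[of y]] by (intro exI[of _ y]) auto
qed

lemma bessel_entire_neg_log_deriv_large:
  assumes "\<nu> > -1"
  shows "\<exists>y\<ge>1. real m * bessel_entire \<nu> (- y) < y * (bessel_entire (\<nu> + 1) (- y) / (4 * (\<nu> + 1)))"
proof -
  define c where "c k = bessel_coeff \<nu> k * (- 1) ^ k" for k
  have c: "c k > 0" for k using bessel_coeff_neg_power_pos[OF assms(1)] by (simp add: c_def)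
  \<comment> \<open>The right-hand side is \<open>y\<close> times the derivative of
    \<open>bessel_entire \<nu> (- y)\<close> in \<open>y\<close>, which multiplies the coefficient
    of \<open>y ^ k\<close> by \<open>k\<close>; subtracting the left-hand side leaves the factor
    \<open>k - m\<close>.\<close>
  define d where "d k = (real k - real m) * c k" for k
  have "(\<lambda>k. real k * bessel_coeff \<nu> k * (- y) ^ k - real m * (bessel_coeff \<nu> k * (- y) ^ k))
     sums (- (- y * bessel_entire (\<nu> + 1) (- y) / (4 * (\<nu> + 1))) - real m * bessel_entire \<nu> (- y))" for y
    by (intro sums_diff sums_mult sums_index_bessel_coeff sums_bessel_entire assms)
  moreover have "real k * bessel_coeff \<nu> k * (- y) ^ k - real m * (bessel_coeff \<nu> k * (- y) ^ k) = d k * y ^ k" for k y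
  proof -
    have "real k * bessel_coeff \<nu> k * (- y) ^ k - real m * (bessel_coeff \<nu> k * (- y) ^ k) =
        (real k - real m) * (bessel_coeff \<nu> k * (- y) ^ k)"
      by (simp add: algebra_simps)
    also have "\<dots> = d k * y ^ k"
      by (subst bessel_coeff_neg_power) (simp add: d_def c_def)
    finally show ?thesis .
  qed
  ultimately have sums: "(\<lambda>k. d k * y ^ k) sums
      (y * (bessel_entire (\<nu> + 1) (- y) / (4 * (\<nu> + 1))) - real m * bessel_entire \<nu> (- y))" for y
    by simp
  have "d k > 0" if "k \<ge> Suc m" for k using that c by (simp add: d_def)
  then obtain y where "y \<ge> 1" "0 < (\<Sum>k. d k * y ^ k)"
    using power_series_pos_somewhere[of "Suc m" d, OF _ _ _ sums_summable[OF sums]] by (auto simp: less_imp_le)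
  then show ?thesis using sums_unique[OF sums[of y]] by (intro exI[of _ y]) auto
qed

lemma bessel_entire_partial_fractions:
  assumes "\<nu> > -1"
  obtains z :: "nat \<Rightarrow> real" where "strict_mono z" "\<And>j. z j > 0"
    "\<And>x. bessel_entire \<nu> x = 0 \<longleftrightarrow> x \<in> range z"
    "\<And>x. bessel_entire \<nu> x \<noteq> 0 \<Longrightarrow>
      (\<lambda>j. 1 / (z j - x)) sums (bessel_entire (\<nu> + 1) x / (4 * (\<nu> + 1) * bessel_entire \<nu> x))"
proof -
  \<comment> \<open>Minus the linear coefficient of the Bessel series and of each approximant, hence
    the sum of the inverse roots of every approximant.\<close>
  define s where "s = 1 / (4 * (\<nu> + 1))"
  have s: "s > 0" using assms by (simp add: s_def)
  obtain t0 :: "nat \<Rightarrow> nat \<Rightarrow> real" where t0: "\<And>n j. t0 n j \<ge> 0" "\<And>n. antimono (t0 n)" "\<And>n j. n < j \<Longrightarrow> t0 n j = 0"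
    "\<And>n. bessel_approx \<nu> n = (\<Prod>j\<le>n. [:1, - t0 n j:])"
    using bessel_approx_factorization[OF assms] by blast
  have poly: "poly (bessel_approx \<nu> n) x = (\<Prod>j\<le>n. 1 - x * t0 n j)" for n x
    by (simp add: t0(4) poly_prod)
  have deriv: "poly (pderiv (bessel_approx \<nu> n)) x = - (\<Sum>j\<le>n. t0 n j * (\<Prod>i\<in>{..n} - {j}. 1 - x * t0 n i))" for n x
    unfolding t0(4) by (rule poly_pderiv_prod_linear)
  have sum: "(\<Sum>j\<le>n. t0 n j) = s" for n
  proof -
    have "coeff (bessel_approx \<nu> n) (Suc 0) = - s"
      by (simp add: coeff_bessel_approx[OF assms] bessel_coeff_Suc bessel_damping_def s_def)
    then show ?thesis
      using deriv[of n 0] by (simp add: poly_0_coeff_0 coeff_pderiv)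
  qed
  have bdd: "bounded (range (\<lambda>n. t0 n j))" for j
  proof (rule boundedI[of _ s], safe)
    fix n
    show "norm (t0 n j) \<le> s"
    proof (cases "j \<le> n")
      case True
      then have "t0 n j \<le> (\<Sum>i\<le>n. t0 n i)" using t0(1) by (intro member_le_sum) auto
      then show ?thesis using t0(1) by (simp add: sum)
    next
      case False
      then show ?thesis using t0(3)[of n j] s by simp
    qed
  qed
  obtain r \<tau> where r: "strict_mono (r :: nat \<Rightarrow> nat)" and "\<forall>j. (\<lambda>n. t0 (r n) j) \<longlonglongrightarrow> \<tau> j"
    using diagonal_convergent_subsequence[of t0, OF bdd] by auto
  then have \<tau>: "(\<lambda>n. t0 (r n) j) \<longlonglongrightarrow> \<tau> j" for j by simp

  interpret positive_roots_limit "\<lambda>n. t0 (r n)" r \<tau> s "bessel_entire \<nu>" "\<lambda>x. - bessel_entire (\<nu> + 1) x / (4 * (\<nu> + 1))"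
  proof
    fix x
    show "(\<lambda>n. \<Prod>j\<le>r n. 1 - x * t0 (r n) j) \<longlonglongrightarrow> bessel_entire \<nu> x"
      using LIMSEQ_subseq_LIMSEQ[OF bessel_approx_tendsto(1)[OF assms] r] by (simp add: o_def poly)
    show "(\<lambda>n. - (\<Sum>j\<le>r n. t0 (r n) j * (\<Prod>i\<in>{..r n} - {j}. 1 - x * t0 (r n) i))) \<longlonglongrightarrow>
        - bessel_entire (\<nu> + 1) x / (4 * (\<nu> + 1))"
      using LIMSEQ_subseq_LIMSEQ[OF bessel_approx_tendsto(2)[OF assms] r] by (simp add: o_def deriv)
    show "- bessel_entire (\<nu> + 1) x / (4 * (\<nu> + 1)) \<noteq> 0" if "bessel_entire \<nu> x = 0"
      using bessel_entire_no_common_zero[OF assms that] assms by simp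
  qed (use t0 \<tau> sum in auto)
  \<comment> \<open>The part of the inverse root sum lost in the limit; it would show up as a factor
    \<open>exp (- a x)\<close> beside the product over the zeros.\<close>
  define a where "a = s - suminf \<tau>"
  have a: "a \<ge> 0" using suminf_tau_le by (simp add: a_def)
  have main: "(\<lambda>j. \<tau> j / (1 - x * \<tau> j)) sums
      (bessel_entire (\<nu> + 1) x / (4 * (\<nu> + 1) * bessel_entire \<nu> x) - a)" if "bessel_entire \<nu> x \<noteq> 0" for x
  proof -
    have ne: "x * \<tau> j \<noteq> 1" for j using that limit_zero_iff by blast
    have "(\<lambda>j. \<tau> j + x * (\<tau> j)\<^sup>2 / (1 - x * \<tau> j)) sums (suminf \<tau> + (\<Sum>j. x * (\<tau> j)\<^sup>2 / (1 - x * \<tau> j)))"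
      by (intro sums_add summable_sums tau_summable log_deriv_series(2) ne)
    moreover have "\<tau> j + x * (\<tau> j)\<^sup>2 / (1 - x * \<tau> j) = \<tau> j / (1 - x * \<tau> j)" for j
      using ne[of j] by (simp add: field_simps power2_eq_square)
    moreover have "suminf \<tau> + (\<Sum>j. x * (\<tau> j)\<^sup>2 / (1 - x * \<tau> j)) =
        bessel_entire (\<nu> + 1) x / (4 * (\<nu> + 1) * bessel_entire \<nu> x) - a"
    proof -
      have "bessel_entire (\<nu> + 1) x / (4 * (\<nu> + 1)) =
          bessel_entire \<nu> x * (s + (\<Sum>j. x * (\<tau> j)\<^sup>2 / (1 - x * \<tau> j)))"
        using log_deriv_series(1)[OF ne] by simp
      then have "bessel_entire (\<nu> + 1) x / (4 * (\<nu> + 1)) / bessel_entire \<nu> x =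
          s + (\<Sum>j. x * (\<tau> j)\<^sup>2 / (1 - x * \<tau> j))"
        using that by simp
      then show ?thesis by (simp only: a_def divide_divide_eq_left)
    qed
    ultimately show ?thesis by simp
  qed
  have neg: "(\<lambda>j. \<tau> j / (1 + y * \<tau> j)) sums
      (bessel_entire (\<nu> + 1) (- y) / (4 * (\<nu> + 1) * bessel_entire \<nu> (- y)) - a)" if "y \<ge> 0" for y
    using main[of "- y"] bessel_entire_neg_pos[OF assms that] by simp
  \<comment> \<open>At \<open>- y\<close> the series has nonnegative terms, so the negated
    logarithmic derivative would be at least \<open>a\<close> on the whole negative axis.\<close>
  have "a = 0"
  proof (rule ccontr)
    assume "a \<noteq> 0"
    then obtain y where y: "y \<ge> 1" "bessel_entire (\<nu> + 1) (- y) / (4 * (\<nu> + 1)) < a * bessel_entire \<nu> (- y)"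
      using bessel_entire_neg_log_deriv_small[OF assms, of a] a by auto
    have "0 \<le> bessel_entire (\<nu> + 1) (- y) / (4 * (\<nu> + 1) * bessel_entire \<nu> (- y)) - a"
      by (rule sums_le[OF _ sums_zero neg]) (use y(1) tau_nonneg in auto)
    then have "a \<le> bessel_entire (\<nu> + 1) (- y) / (4 * (\<nu> + 1)) / bessel_entire \<nu> (- y)"
      by (simp only: divide_divide_eq_left diff_ge_0_iff_ge)
    then show False
      using y bessel_entire_neg_pos[OF assms, of y] by (simp only: pos_le_divide_eq)
  qed
  \<comment> \<open>If \<open>\<tau> m\<close> were 0, monotonicity would leave only the indices
    below \<open>m\<close>, each contributing at most \<open>1 / y\<close>, so the negated
    logarithmic derivative at \<open>- y\<close> would be at most \<open>m / y\<close>.\<close>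
  have pos: "\<tau> m > 0" for m
  proof (rule ccontr)
    assume "\<not> \<tau> m > 0"
    then have zero: "\<tau> j = 0" if "m \<le> j" for j
      using antimonoD[OF tau_antimono that] tau_nonneg[of j] by simp
    obtain y where y: "y \<ge> 1" "real m * bessel_entire \<nu> (- y) < y * (bessel_entire (\<nu> + 1) (- y) / (4 * (\<nu> + 1)))"
      using bessel_entire_neg_log_deriv_large[OF assms] by blast
    have "(\<lambda>j. \<tau> j / (1 + y * \<tau> j)) sums (\<Sum>j<m. \<tau> j / (1 + y * \<tau> j))"
      by (rule sums_finite) (auto simp: zero)
    then have "bessel_entire (\<nu> + 1) (- y) / (4 * (\<nu> + 1) * bessel_entire \<nu> (- y)) = (\<Sum>j<m. \<tau> j / (1 + y * \<tau> j))"
      using neg[of y] y(1) \<open>a = 0\<close> sums_unique2 by fastforce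
    moreover have "(\<Sum>j<m. \<tau> j / (1 + y * \<tau> j)) \<le> (\<Sum>j<m. 1 / y)"
    proof (rule sum_mono)
      fix j
      have "1 + y * \<tau> j > 0" using y(1) tau_nonneg[of j] by (intro add_pos_nonneg) auto
      then show "\<tau> j / (1 + y * \<tau> j) \<le> 1 / y" using y(1) by (simp add: field_simps)
    qed
    ultimately have "bessel_entire (\<nu> + 1) (- y) / (4 * (\<nu> + 1) * bessel_entire \<nu> (- y)) \<le> real m / y" by simp
    then have "bessel_entire (\<nu> + 1) (- y) / (4 * (\<nu> + 1)) / bessel_entire \<nu> (- y) \<le> real m / y"
      by (simp only: divide_divide_eq_left)
    then have "bessel_entire (\<nu> + 1) (- y) / (4 * (\<nu> + 1)) * y \<le> real m * bessel_entire \<nu> (- y)"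
      using y(1) bessel_entire_neg_pos[OF assms, of y] frac_le_eq[of "bessel_entire \<nu> (- y)" y]
      by (simp only: pos_divide_le_eq) (simp add: pos_le_divide_eq)
    then show False using y(2) by (simp only: mult.commute)
  qed
  show ?thesis
  proof
    show "strict_mono (\<lambda>j. 1 / \<tau> j)"
      unfolding strict_mono_Suc_iff using tau_Suc_less[OF pos] pos by (simp add: frac_less2)
    show "1 / \<tau> j > 0" for j using pos by simp
    show "bessel_entire \<nu> x = 0 \<longleftrightarrow> x \<in> range (\<lambda>j. 1 / \<tau> j)" for x
    proof -
      have "x * \<tau> j = 1 \<longleftrightarrow> x = 1 / \<tau> j" for j using pos[of j] by (simp add: field_simps)
      then show ?thesis unfolding limit_zero_iff by auto
    qed
    show "(\<lambda>j. 1 / (1 / \<tau> j - x)) sums (bessel_entire (\<nu> + 1) x / (4 * (\<nu> + 1) * bessel_entire \<nu> x))"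
      if "bessel_entire \<nu> x \<noteq> 0" for x
    proof -
      have "1 / (1 / \<tau> j - x) = \<tau> j / (1 - x * \<tau> j)" for j
        using pos[of j] by (simp add: divide_simps)
      then show ?thesis using main[OF that] \<open>a = 0\<close> by simp
    qed
  qed
qed

section \<open>Positive zeros of Bessel functions\<close>

lemma bessel_J_eq:
  assumes "\<nu> > -1" "x > 0"
  shows "bessel_J \<nu> x = (x / 2) powr \<nu> / Gamma (\<nu> + 1) * bessel_entire \<nu> (x\<^sup>2)"
proof -
  have G: "Gamma (\<nu> + 1) > 0" using assms by simp
  have "(-1) ^ k / (fact k * Gamma (\<nu> + real k + 1)) * (x / 2) powr (\<nu> + 2 * real k) =
      (x / 2) powr \<nu> / Gamma (\<nu> + 1) * (bessel_coeff \<nu> k * (x\<^sup>2) ^ k)" for k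
  proof -
    have "\<nu> + 1 \<notin> \<int>\<^sub>\<le>\<^sub>0" using assms nonpos_Ints_nonpos[of "\<nu> + 1"] by force
    then have "Gamma (\<nu> + real k + 1) = pochhammer (\<nu> + 1) k * Gamma (\<nu> + 1)"
      using pochhammer_Gamma[of "\<nu> + 1" k] G by (simp add: add_ac)
    moreover have "(x / 2) powr (\<nu> + 2 * real k) = (x / 2) powr \<nu> * ((x\<^sup>2) ^ k / 4 ^ k)"
    proof -
      have "(x / 2) powr (2 * real k) = (x / 2) ^ (2 * k)"
        using assms powr_realpow[of "x / 2" "2 * k"] by simp
      then show ?thesis by (simp add: powr_add power_mult power_divide)
    qed
    ultimately show ?thesis by (simp add: bessel_coeff_def mult_ac)
  qed
  moreover have "(\<lambda>k. (x / 2) powr \<nu> / Gamma (\<nu> + 1) * (bessel_coeff \<nu> k * (x\<^sup>2) ^ k)) sums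
      ((x / 2) powr \<nu> / Gamma (\<nu> + 1) * bessel_entire \<nu> (x\<^sup>2))"
    by (intro sums_mult sums_bessel_entire assms)
  ultimately show ?thesis by (simp add: bessel_J_def sums_iff)
qed

lemma bessel_J_eq_0_iff:
  assumes "\<nu> > -1" "x > 0"
  shows "bessel_J \<nu> x = 0 \<longleftrightarrow> bessel_entire \<nu> (x\<^sup>2) = 0"
proof -
  have "Gamma (\<nu> + 1) \<noteq> 0" using Gamma_real_pos[of "\<nu> + 1"] assms by linarith
  then show ?thesis using assms by (simp add: bessel_J_eq)
qed

lemma bessel_A_eq:
  assumes "p > -1" "x > 0"
  shows "bessel_A p x = 2 * (p + 1) * bessel_entire p x / (x * bessel_entire (p + 1) x)"
proof -
  have G: "Gamma (p + 1 + 1) = (p + 1) * Gamma (p + 1)"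
    using assms by (intro Gamma_plus1) (use nonpos_Ints_nonpos[of "p + 1"] in force)
  have G': "Gamma (p + 1) \<noteq> 0" using Gamma_real_pos[of "p + 1"] assms by linarith
  define W where "W = (sqrt x / 2) powr p"
  have W: "W \<noteq> 0" "sqrt x * (sqrt x / 2) powr (p + 1) = W * x / 2"
    using assms by (simp_all add: powr_add W_def)
  have "bessel_A p x = (W / Gamma (p + 1) * bessel_entire p x) /
      ((sqrt x * (sqrt x / 2) powr (p + 1)) / ((p + 1) * Gamma (p + 1)) * bessel_entire (p + 1) x)"
    using assms G by (simp add: bessel_A_def bessel_J_eq W_def)
  then show ?thesis unfolding W(2) using W(1) G' assms by (simp add: divide_simps)
qed

text \<open>Exactly the zeros with indices \<open>0..j\<close> lie at or below
  \<open>sqrt (z j)\<close>, so the cardinality in the definition is \<open>j + 1\<close>; this is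
  the shift between counting from 1 and enumerating from 0.\<close>

lemma bessel_zero_Suc:
  fixes z :: "nat \<Rightarrow> real"
  assumes "\<nu> > -1" "strict_mono z" "\<And>j. z j > 0" "\<And>x. bessel_entire \<nu> x = 0 \<longleftrightarrow> x \<in> range z"
  shows "bessel_zero \<nu> (Suc m) = sqrt (z m)"
proof -
  have zero: "bessel_J \<nu> y = 0 \<longleftrightarrow> (\<exists>j. y = sqrt (z j))" if "y > 0" for y
  proof -
    have "y\<^sup>2 = z j \<longleftrightarrow> y = sqrt (z j)" for j
      using that assms(3)[of j] real_sqrt_unique[of y "z j"] by auto
    then show ?thesis using that assms(1,4) by (auto simp: bessel_J_eq_0_iff)
  qed
  have card: "card {y. 0 < y \<and> y \<le> sqrt (z j) \<and> bessel_J \<nu> y = 0} = Suc j" for j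
  proof -
    have "{y. 0 < y \<and> y \<le> sqrt (z j) \<and> bessel_J \<nu> y = 0} = (\<lambda>i. sqrt (z i)) ` {..j}"
      using zero assms(3) strict_mono_less_eq[OF assms(2)] by auto
    moreover have "inj_on (\<lambda>i. sqrt (z i)) {..j}"
      using strict_mono_eq[OF assms(2)] by (auto simp: inj_on_def)
    ultimately show ?thesis by (simp add: card_image)
  qed
  show ?thesis
    unfolding bessel_zero_def
  proof (rule the_equality)
    show "0 < sqrt (z m) \<and> bessel_J \<nu> (sqrt (z m)) = 0 \<and>
        card {y. 0 < y \<and> y \<le> sqrt (z m) \<and> bessel_J \<nu> y = 0} = Suc m"
      using assms(3) zero card by auto
    fix x assume x: "0 < x \<and> bessel_J \<nu> x = 0 \<and> card {y. 0 < y \<and> y \<le> x \<and> bessel_J \<nu> y = 0} = Suc m"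
    then obtain j where "x = sqrt (z j)" using zero by blast
    then show "x = sqrt (z m)" using x card by auto
  qed
qed

section \<open>Taylor coefficients\<close>

text \<open>The induction passes to the derivative of both the function and the series. Besides
  identifying the Taylor coefficients, this yields uniqueness of expansions.\<close>

lemma has_fps_expansion_imp_fps_nth:
  fixes f :: "real \<Rightarrow> real"
  assumes "f has_fps_expansion F"
  shows "fps_nth F n = (deriv ^^ n) f 0 / fact n"
  using assms
proof (induction n arbitrary: f F)
  case 0
  then have "eval_fps F 0 = f 0"
    unfolding has_fps_expansion_def using eventually_nhds_x_imp_x by blast
  then show ?case by (simp add: eval_fps_at_0)
next
  case (Suc n)
  have "fps_nth (fps_deriv F) n = (deriv ^^ n) (deriv f) 0 / fact n"
    by (rule Suc.IH[OF has_fps_expansion_deriv[OF Suc.prems]])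
  then have "real (Suc n) * fps_nth F (Suc n) = (deriv ^^ Suc n) f 0 / fact n"
    by (simp add: funpow_swap1)
  then have "real (Suc n) * fps_nth F (Suc n) / real (Suc n) = (deriv ^^ Suc n) f 0 / fact n / real (Suc n)"
    by (rule arg_cong)
  then show ?case by (simp only: nonzero_mult_div_cancel_left of_nat_neq_0 not_False_eq_True
      divide_divide_eq_left fact_Suc mult.commute of_nat_mult)
qed

lemma real_has_fps_expansion_unique:
  fixes f :: "real \<Rightarrow> real"
  assumes "f has_fps_expansion F" "f has_fps_expansion G"
  shows "F = G"
  using assms by (intro fps_ext) (simp add: has_fps_expansion_imp_fps_nth)

text \<open>Each term is a geometric series in \<open>u / w m\<close>. The remainder after
  \<open>K\<close> terms is summed over \<open>m\<close> explicitly and is at most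
  \<open>q ^ K * C\<close>, which replaces an interchange of two infinite sums.\<close>

lemma has_fps_expansion_partial_fractions:
  fixes w :: "nat \<Rightarrow> real"
  assumes "summable (\<lambda>m. \<bar>1 / w m\<bar>)" "\<And>m. w m \<noteq> 0"
  shows "(\<lambda>u. \<Sum>m. 1 / (w m - u)) has_fps_expansion Abs_fps (\<lambda>k. \<Sum>m. 1 / w m ^ Suc k)"
proof (rule has_fps_expansionI)
  \<comment> \<open>A common bound for all \<open>\<bar>1 / w m\<bar>\<close>, so that
    \<open>\<bar>u\<bar> < 1 / B\<close> makes the geometric series converge uniformly in
    \<open>m\<close>.\<close>
  define B where "B = (\<Sum>m. \<bar>1 / w m\<bar>)"
  have le: "\<bar>1 / w m\<bar> \<le> B" for m
    unfolding B_def using sum_le_suminf[OF assms(1), of "{m}"] by simp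
  moreover have "\<bar>1 / w 0\<bar> > 0" using assms(2) by simp
  ultimately have B: "B > 0" using less_le_trans by blast
  have summ: "summable (\<lambda>m. 1 / w m ^ Suc k)" for k
  proof (rule summable_comparison_test')
    show "summable (\<lambda>m. B ^ k * \<bar>1 / w m\<bar>)" by (intro summable_mult assms)
    fix m
    have "\<bar>1 / w m\<bar> ^ k \<le> B ^ k" using le by (intro power_mono) auto
    from mult_right_mono[OF this, of "\<bar>1 / w m\<bar>"]
    show "norm (1 / w m ^ Suc k) \<le> B ^ k * \<bar>1 / w m\<bar>"
      by (simp add: power_abs power_divide abs_mult mult_ac)
  qed
  have "(\<lambda>k. (\<Sum>m. 1 / w m ^ Suc k) * u ^ k) sums (\<Sum>m. 1 / (w m - u))" if u: "u \<in> ball 0 (1 / B)" for u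
  proof -
    define q where "q = \<bar>u\<bar> * B"
    have q: "0 \<le> q" "q < 1" using u B by (auto simp: q_def field_simps)
    have ratio: "\<bar>u / w m\<bar> \<le> q" for m
      using mult_left_mono[OF le[of m], of "\<bar>u\<bar>"] by (simp add: q_def abs_mult)
    have ne: "w m - u \<noteq> 0" for m
    proof
      assume "w m - u = 0"
      then have "w m = u" by simp
      then have "u / w m = 1" using assms(2)[of m] by simp
      then show False using ratio[of m] q by simp
    qed
    have inv: "\<bar>1 / (w m - u)\<bar> \<le> \<bar>1 / w m\<bar> / (1 - q)" for m
    proof -
      have "1 - q \<le> \<bar>1 - u / w m\<bar>" using ratio[of m] by linarith
      moreover from this have "0 < \<bar>1 - u / w m\<bar>" using q by linarith
      ultimately have "\<bar>1 / w m\<bar> / \<bar>1 - u / w m\<bar> \<le> \<bar>1 / w m\<bar> / (1 - q)"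
        using q by (intro divide_left_mono mult_pos_pos) auto
      moreover have "1 / (w m - u) = 1 / w m / (1 - u / w m)"
        using assms(2)[of m] ne[of m] by (simp add: field_simps)
      ultimately show ?thesis by (metis abs_divide)
    qed
    have summ2: "summable (\<lambda>m. \<bar>1 / (w m - u)\<bar>)"
      by (rule summable_comparison_test'[OF summable_divide[OF assms(1)]]) (use inv in simp)
    define C where "C = (\<Sum>m. \<bar>1 / (w m - u)\<bar>)"
    have rem: "\<bar>(\<Sum>k<K. (\<Sum>m. 1 / w m ^ Suc k) * u ^ k) - (\<Sum>m. 1 / (w m - u))\<bar> \<le> q ^ K * C" for K
    proof -
      have geo: "(\<Sum>k<K. 1 / w m ^ Suc k * u ^ k) - 1 / (w m - u) = - ((u / w m) ^ K * (1 / (w m - u)))" for m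
      proof -
        have "u / w m \<noteq> 1" using ne[of m] assms(2)[of m] by (simp add: field_simps)
        have "(\<Sum>k<K. 1 / w m ^ Suc k * u ^ k) = 1 / w m * (\<Sum>k<K. (u / w m) ^ k)"
          by (simp add: sum_distrib_left power_divide)
        also have "\<dots> = 1 / w m * (((u / w m) ^ K - 1) / (u / w m - 1))"
          using \<open>u / w m \<noteq> 1\<close> by (simp add: geometric_sum)
        also have "\<dots> = (1 - (u / w m) ^ K) * (1 / (w m - u))"
        proof -
          have "(w m - u) / w m = 1 - u / w m" using assms(2)[of m] by (simp add: diff_divide_distrib)
          then have "1 / w m / (u / w m - 1) = - (1 / (w m - u))"
            using assms(2)[of m] ne[of m] by (simp add: field_simps)
          moreover have "1 / w m * (((u / w m) ^ K - 1) / (u / w m - 1)) =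
              ((u / w m) ^ K - 1) * (1 / w m / (u / w m - 1))"
            by (metis mult.commute times_divide_eq_right)
          moreover have "((u / w m) ^ K - 1) * - (1 / (w m - u)) = (1 - (u / w m) ^ K) * (1 / (w m - u))"
            using minus_mult_commute[of "(u / w m) ^ K - 1" "1 / (w m - u)"] by (metis minus_diff_eq)
          ultimately show ?thesis by metis
        qed
        finally show ?thesis by (simp only: left_diff_distrib mult_1)
      qed
      have "(\<lambda>m. (\<Sum>k<K. 1 / w m ^ Suc k * u ^ k) - 1 / (w m - u)) sums
         ((\<Sum>k<K. (\<Sum>m. 1 / w m ^ Suc k) * u ^ k) - (\<Sum>m. 1 / (w m - u)))"
      proof (intro sums_diff sums_sum sums_mult2 summable_sums summ)
        show "summable (\<lambda>m. 1 / (w m - u))"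
          using summ2 by (intro summable_norm_cancel[of "\<lambda>m. 1 / (w m - u)"]) simp
      qed
      then have s: "(\<lambda>m. - ((u / w m) ^ K * (1 / (w m - u)))) sums
         ((\<Sum>k<K. (\<Sum>m. 1 / w m ^ Suc k) * u ^ k) - (\<Sum>m. 1 / (w m - u)))"
        by (simp only: geo)
      have "norm (- ((u / w m) ^ K * (1 / (w m - u)))) \<le> q ^ K * \<bar>1 / (w m - u)\<bar>" for m
        unfolding real_norm_def abs_minus_cancel abs_mult power_abs
        by (intro mult_right_mono power_mono ratio) auto
      from norm_suminf_le[OF this summable_mult[OF summ2]] show ?thesis
        using sums_unique[OF s] suminf_mult[OF summ2, of "q ^ K"] by (simp add: C_def)
    qed
    have "(\<lambda>K. q ^ K * C) \<longlonglongrightarrow> 0"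
      using tendsto_mult_left_zero[OF LIMSEQ_realpow_zero[OF q], of C] by simp
    then have "(\<lambda>K. (\<Sum>k<K. (\<Sum>m. 1 / w m ^ Suc k) * u ^ k) - (\<Sum>m. 1 / (w m - u))) \<longlonglongrightarrow> 0"
      by (rule Lim_null_comparison[rotated]) (use rem in \<open>auto intro!: always_eventually\<close>)
    then show ?thesis unfolding sums_def by (rule LIM_zero_cancel)
  qed
  then show "eventually (\<lambda>u. (\<lambda>k. fps_nth (Abs_fps (\<lambda>k. \<Sum>m. 1 / w m ^ Suc k)) k * u ^ k) sums
      (\<Sum>m. 1 / (w m - u))) (nhds 0)"
    using B by (intro eventually_mono[OF eventually_nhds_in_open[of "ball 0 (1 / B)"]]) auto
qed

lemma has_fps_expansion_inverse_shift:
  fixes c :: real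
  assumes "c \<noteq> 0"
  shows "(\<lambda>u. 1 / (c + u)) has_fps_expansion Abs_fps (\<lambda>k. (-1) ^ k / c ^ Suc k)"
proof (rule has_fps_expansionI)
  have "(\<lambda>k. (-1) ^ k / c ^ Suc k * u ^ k) sums (1 / (c + u))" if "u \<in> ball 0 \<bar>c\<bar>" for u
  proof -
    have "norm (- u / c) < 1" using that assms by (simp add: field_simps)
    from sums_mult[OF geometric_sums[OF this], of "1 / c"]
    have "(\<lambda>k. 1 / c * (- u / c) ^ k) sums (1 / c * (1 / (1 - - u / c)))" .
    moreover have "1 / c * (- u / c) ^ k = (-1) ^ k / c ^ Suc k * u ^ k" for k
    proof -
      have "(- u / c) ^ k = (-1) ^ k * u ^ k / c ^ k"
        by (simp only: power_divide power_minus[of u])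
      then show ?thesis by simp
    qed
    moreover have "1 / c * (1 / (1 - - u / c)) = 1 / (c + u)"
      using assms by (simp add: field_simps)
    ultimately show ?thesis by simp
  qed
  then show "eventually (\<lambda>u. (\<lambda>k. fps_nth (Abs_fps (\<lambda>k. (-1) ^ k / c ^ Suc k)) k * u ^ k) sums (1 / (c + u))) (nhds 0)"
    using assms by (intro eventually_mono[OF eventually_nhds_in_open[of "ball 0 \<bar>c\<bar>"]]) auto
qed

text \<open>The contiguous relation divided by \<open>x * bessel_entire (p + 1) x\<close>. The
  subtracted quotient has the form of the partial fraction sum over the zeros for order
  \<open>p + 1\<close>.\<close>

lemma bessel_A_partial_fractions:
  assumes "p > -1" "x > 0" "bessel_entire (p + 1) x \<noteq> 0"
  shows "bessel_A p x = 2 * (p + 1) / x - 2 * (bessel_entire (p + 1 + 1) x / (4 * (p + 1 + 1) * bessel_entire (p + 1) x))"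
proof -
  have "(p + 1) * bessel_entire p x / (x * bessel_entire (p + 1) x) =
    (p + 1) / x - bessel_entire (p + 2) x / (4 * (p + 2) * bessel_entire (p + 1) x)"
    unfolding bessel_entire_contiguous[OF assms(1)]
    using assms by (simp add: divide_simps)
  moreover have "bessel_A p x = 2 * ((p + 1) * bessel_entire p x / (x * bessel_entire (p + 1) x))"
    using assms by (simp add: bessel_A_eq mult.assoc)
  ultimately show ?thesis by (simp add: right_diff_distrib add.assoc)
qed

text \<open>The derivative of \<open>P\<close> is a multiple of \<open>Q\<close>, and the contiguous
  relation expresses that of \<open>Q\<close> through \<open>P\<close> and \<open>Q\<close>; the
  quotient rule therefore closes up to a Riccati equation in \<open>P / (x Q)\<close>.\<close>

lemma has_real_derivative_bessel_A:
  assumes "p > -1" "x > 0" "bessel_entire (p + 1) x \<noteq> 0"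
  shows "(bessel_A p has_real_derivative
    (2 * p * bessel_A p x - 1 - x * (bessel_A p x)\<^sup>2) / (2 * x)) (at x)"
proof -
  define P where "P = bessel_entire p"
  define Q where "Q = bessel_entire (p + 1)"
  have Q: "Q x \<noteq> 0" using assms by (simp add: Q_def)
  have dP: "(P has_real_derivative - Q x / (4 * (p + 1))) (at x)"
    unfolding P_def Q_def by (rule has_real_derivative_bessel_entire[OF assms(1)])
  have "(Q has_real_derivative - bessel_entire (p + 2) x / (4 * (p + 2))) (at x)"
    using has_real_derivative_bessel_entire[of "p + 1" x] assms by (simp add: Q_def add_ac)
  moreover have "- bessel_entire (p + 2) x / (4 * (p + 2)) = (p + 1) * (P x - Q x) / x"
    using bessel_entire_contiguous[OF assms(1), of x] assms by (simp add: P_def Q_def field_simps)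
  ultimately have dQ: "(Q has_real_derivative (p + 1) * (P x - Q x) / x) (at x)" by simp
  define D where "D = (2 * (p + 1) * (- Q x / (4 * (p + 1))) * (x * Q x)
      - 2 * (p + 1) * P x * (Q x + x * ((p + 1) * (P x - Q x) / x))) / (x * Q x)\<^sup>2"
  have "((\<lambda>x. 2 * (p + 1) * P x / (x * Q x)) has_real_derivative D) (at x)"
    unfolding D_def using assms Q
    by (auto intro!: derivative_eq_intros dP dQ simp: power2_eq_square)
  moreover have "D = (2 * p * bessel_A p x - 1 - x * (bessel_A p x)\<^sup>2) / (2 * x)"
  proof -
    have A: "bessel_A p x = 2 * (p + 1) * P x / (x * Q x)"
      using bessel_A_eq[OF assms(1,2)] by (simp add: P_def Q_def)
    have "2 * (p + 1) * (- Q x / (4 * (p + 1))) = - Q x / 2" "x * ((p + 1) * (P x - Q x) / x) = (p + 1) * (P x - Q x)"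
      using assms by (simp_all add: field_simps)
    then have "D = ((- Q x / 2) * (x * Q x) - 2 * (p + 1) * P x * (Q x + (p + 1) * (P x - Q x))) / (x * Q x)\<^sup>2"
      unfolding D_def by (simp only:)
    also have "\<dots> = (2 * p * bessel_A p x - 1 - x * (bessel_A p x)\<^sup>2) / (2 * x)"
      unfolding A using assms Q by (simp add: divide_simps power2_eq_square) (simp add: algebra_simps)
    finally show ?thesis .
  qed
  moreover have "eventually (\<lambda>y. bessel_A p y = 2 * (p + 1) * P y / (y * Q y)) (nhds x)"
    using eventually_nhds_in_open[of "{0<..}" x] assms
    by (auto elim!: eventually_mono simp: bessel_A_eq P_def Q_def)
  ultimately show ?thesis by (simp add: DERIV_cong_ev)
qed

lemma sum_convolution_drop_ends:
  fixes \<alpha> :: "nat \<Rightarrow> real"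
  assumes "\<alpha> 0 = 0"
  shows "(\<Sum>i=0..n. \<alpha> i * \<alpha> (n - i)) = (\<Sum>i=1..n - 1. \<alpha> i * \<alpha> (n - i))"
proof (rule sum.mono_neutral_right)
  show "\<forall>i\<in>{0..n} - {1..n - 1}. \<alpha> i * \<alpha> (n - i) = 0"
  proof
    fix i assume "i \<in> {0..n} - {1..n - 1}"
    then have "i = 0 \<or> i = n" by auto
    then show "\<alpha> i * \<alpha> (n - i) = 0" using assms by auto
  qed
qed auto

lemma riccati_taylor_coefficients:
  fixes g :: "real \<Rightarrow> real" and \<zeta> p :: real and \<alpha> :: "nat \<Rightarrow> real"
  assumes "\<zeta> \<noteq> 0" and exp: "g has_fps_expansion Abs_fps \<alpha>" and "\<alpha> 0 = 0"
    and ode: "eventually (\<lambda>u. 2 * (\<zeta> + u) * deriv g u = 2 * p * g u - 1 - (\<zeta> + u) * (g u)\<^sup>2) (nhds 0)"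
  shows "\<alpha> 1 = - 1 / (2 * \<zeta>)"
    and "k \<ge> 1 \<Longrightarrow> \<alpha> (k + 1) = - 1 / (2 * \<zeta> * (real k + 1)) *
        (2 * (real k - p) * \<alpha> k + \<zeta> * (\<Sum>j=1..k - 1. \<alpha> j * \<alpha> (k - j))
          + (\<Sum>j=1..k - 2. \<alpha> j * \<alpha> (k - 1 - j)))"
proof -
  define F where "F = Abs_fps \<alpha>"
  have F: "g has_fps_expansion F" using exp by (simp add: F_def)
  have "(\<lambda>u. 2 * ((\<zeta> + u) * deriv g u) - 2 * p * g u + 1 + (\<zeta> + u) * (g u * g u)) has_fps_expansion
      fps_const 2 * ((fps_const \<zeta> + fps_X) * fps_deriv F) - fps_const (2 * p) * F + 1 + (fps_const \<zeta> + fps_X) * (F * F)"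
    by (intro fps_expansion_intros F)
  moreover have "(\<lambda>u. 2 * ((\<zeta> + u) * deriv g u) - 2 * p * g u + 1 + (\<zeta> + u) * (g u * g u)) has_fps_expansion 0"
  proof -
    have "eventually (\<lambda>u. 0 = 2 * ((\<zeta> + u) * deriv g u) - 2 * p * g u + 1 + (\<zeta> + u) * (g u * g u)) (nhds 0)"
      using ode by eventually_elim (simp add: power2_eq_square algebra_simps)
    then show ?thesis by (auto simp: has_fps_expansion_def)
  qed
  ultimately have "fps_const 2 * ((fps_const \<zeta> + fps_X) * fps_deriv F) - fps_const (2 * p) * F + 1
      + (fps_const \<zeta> + fps_X) * (F * F) = 0"
    by (rule real_has_fps_expansion_unique)
  moreover define G where "G = F * F"
  ultimately have eq: "fps_nth (fps_const 2 * ((fps_const \<zeta> + fps_X) * fps_deriv F) - fps_const (2 * p) * F + 1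
      + (fps_const \<zeta> + fps_X) * G) k = 0" for k
    by simp
  have nth: "fps_nth F k = \<alpha> k" for k by (simp add: F_def)
  have conv: "fps_nth G k = (\<Sum>j=1..k - 1. \<alpha> j * \<alpha> (k - j))" for k
    using sum_convolution_drop_ends[of \<alpha> k, OF \<open>\<alpha> 0 = 0\<close>] by (simp add: G_def fps_mult_nth nth)
  show "\<alpha> 1 = - 1 / (2 * \<zeta>)"
    using eq[of 0] conv[of 0] assms by (simp add: nth distrib_right) (simp add: field_simps)
  assume k: "k \<ge> 1"
  have solve: "a = - 1 / D * X" if "D * a = - X" "D \<noteq> 0" for a D X :: real
    using that by (simp add: field_simps)
  \<comment> \<open>The coefficient of \<open>u ^ k\<close>: multiplication by \<open>u\<close>
    shifts the index, giving \<open>k \<alpha>_k\<close> from the derivative and the convolution at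
    \<open>k - 1\<close> from the square. For \<open>k = 1\<close> truncated subtraction makes the
    upper limit \<open>k - 2\<close> zero and the sum empty.\<close>
  have "2 * (\<zeta> * (real k + 1) * \<alpha> (k + 1) + real k * \<alpha> k) - 2 * p * \<alpha> k
      + \<zeta> * (\<Sum>j=1..k - 1. \<alpha> j * \<alpha> (k - j)) + (\<Sum>j=1..k - 2. \<alpha> j * \<alpha> (k - 1 - j)) = 0"
  proof -
    have "fps_nth (fps_const 2 * ((fps_const \<zeta> + fps_X) * fps_deriv F) - fps_const (2 * p) * F + 1
      + (fps_const \<zeta> + fps_X) * G) k = 2 * (\<zeta> * ((real k + 1) * \<alpha> (k + 1)) + real k * \<alpha> k)
      - 2 * p * \<alpha> k + (\<zeta> * fps_nth G k + fps_nth G (k - 1))"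
      using k by (cases k) (simp_all add: nth distrib_right)
    then show ?thesis
      using eq[of k] conv[of k] conv[of "k - 1", unfolded diff_diff_left one_add_one]
      by (simp add: mult.assoc add.assoc)
  qed
  then have "2 * \<zeta> * (real k + 1) * \<alpha> (k + 1) = - (2 * (real k - p) * \<alpha> k
      + \<zeta> * (\<Sum>j=1..k - 1. \<alpha> j * \<alpha> (k - j)) + (\<Sum>j=1..k - 2. \<alpha> j * \<alpha> (k - 1 - j)))"
    by (simp add: algebra_simps)
  moreover have "2 * \<zeta> * (real k + 1) \<noteq> 0" using assms by simp
  ultimately show "\<alpha> (k + 1) = - 1 / (2 * \<zeta> * (real k + 1)) *
        (2 * (real k - p) * \<alpha> k + \<zeta> * (\<Sum>j=1..k - 1. \<alpha> j * \<alpha> (k - j))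
          + (\<Sum>j=1..k - 2. \<alpha> j * \<alpha> (k - 1 - j)))"
    by (rule solve)
qed

text \<open>Summability forces \<open>z j\<close> to infinity, and
  \<open>z j > 2 \<bar>c\<bar> + 1\<close> already gives
  \<open>\<bar>z j - c\<bar> \<ge> z j / 2\<close>.\<close>

lemma summable_inverse_shift:
  fixes z :: "nat \<Rightarrow> real"
  assumes "summable (\<lambda>j. 1 / z j)" "\<And>j. z j > 0"
  shows "summable (\<lambda>j. \<bar>1 / (z j - c)\<bar>)"
proof (rule summable_comparison_test_ev)
  show "summable (\<lambda>j. 2 * (1 / z j))" by (rule summable_mult[OF assms(1)])
  have "eventually (\<lambda>j. 1 / z j < 1 / (2 * \<bar>c\<bar> + 1)) sequentially"
    using summable_LIMSEQ_zero[OF assms(1)] by (rule order_tendstoD) simp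
  then show "eventually (\<lambda>j. norm \<bar>1 / (z j - c)\<bar> \<le> 2 * (1 / z j)) sequentially"
  proof eventually_elim
    case (elim j)
    then have "2 * \<bar>c\<bar> + 1 < z j" using assms(2)[of j] by (simp add: field_simps)
    then have "z j / 2 \<le> \<bar>z j - c\<bar>" "0 < \<bar>z j - c\<bar>" by linarith+
    then have "1 / \<bar>z j - c\<bar> \<le> 1 / (z j / 2)" using assms(2)[of j] by (intro divide_left_mono) auto
    then show ?case by simp
  qed
qed

theorem mainTheorem1:
  fixes p \<zeta> :: real and n :: nat and \<alpha> :: "nat \<Rightarrow> real"
  assumes "p > -1"
    and "n \<ge> 1"
    and "\<zeta> = (bessel_zero p n)\<^sup>2"
    and "\<And>k. \<alpha> k = (deriv ^^ k) (bessel_A p) \<zeta> / fact k"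
  shows "\<alpha> 0 = 0 \<and> \<alpha> 1 = - 1 / (2 * \<zeta>) \<and>
    (\<forall>k\<ge>1. \<alpha> (k + 1) = - 1 / (2 * \<zeta> * (real k + 1)) *
        (2 * (real k - p) * \<alpha> k
          + \<zeta> * (\<Sum>j=1..k - 1. \<alpha> j * \<alpha> (k - j))
          + (\<Sum>j=1..k - 2. \<alpha> j * \<alpha> (k - 1 - j)))) \<and>
    (\<forall>r\<ge>2. (\<lambda>m. (bessel_zero p n)\<^sup>2 * (bessel_zero (p + 1) (Suc m))\<^sup>2 /
                ((bessel_zero (p + 1) (Suc m))\<^sup>2 - (bessel_zero p n)\<^sup>2) ^ r)
        sums (- (1 / 2) * ((bessel_zero p n)\<^sup>2 * \<alpha> (r - 2) + (bessel_zero p n) ^ 4 * \<alpha> (r - 1))))"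
proof -
  obtain y :: "nat \<Rightarrow> real" where y: "strict_mono y" "\<And>j. y j > 0"
    "\<And>x. bessel_entire p x = 0 \<longleftrightarrow> x \<in> range y"
    using bessel_entire_partial_fractions[OF assms(1)] by metis
  have p1: "p + 1 > -1" using assms(1) by simp
  obtain z :: "nat \<Rightarrow> real" where z: "strict_mono z" "\<And>j. z j > 0"
    "\<And>x. bessel_entire (p + 1) x = 0 \<longleftrightarrow> x \<in> range z"
    "\<And>x. bessel_entire (p + 1) x \<noteq> 0 \<Longrightarrow>
      (\<lambda>j. 1 / (z j - x)) sums (bessel_entire (p + 1 + 1) x / (4 * (p + 1 + 1) * bessel_entire (p + 1) x))"
    using bessel_entire_partial_fractions[OF p1] by metis
  obtain n' where n': "n = Suc n'" using assms(2) by (cases n) auto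
  have zeta: "\<zeta> = y n'"
    using bessel_zero_Suc[OF assms(1) y, of n'] y(2)[of n'] by (simp add: assms(3) n')
  have zero: "(bessel_zero (p + 1) (Suc m))\<^sup>2 = z m" for m
    using bessel_zero_Suc[OF p1 z(1-3), of m] z(2)[of m] by simp
  have pos: "\<zeta> > 0" using y(2) zeta by simp
  have P0: "bessel_entire p \<zeta> = 0" using y(3) zeta by simp
  have Q0: "bessel_entire (p + 1) \<zeta> \<noteq> 0" by (rule bessel_entire_no_common_zero[OF assms(1) P0])
  have near: "eventually (\<lambda>u. \<zeta> + u > 0 \<and> bessel_entire (p + 1) (\<zeta> + u) \<noteq> 0) (nhds 0)"
  proof -
    have cont: "isCont (bessel_entire (p + 1)) x" for x
      using has_real_derivative_bessel_entire[OF p1] by (rule DERIV_isCont)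
    have "((\<lambda>u. bessel_entire (p + 1) (\<zeta> + u)) \<longlongrightarrow> bessel_entire (p + 1) (\<zeta> + 0)) (nhds 0)"
      by (intro isCont_tendsto_compose[OF cont] tendsto_intros filterlim_ident)
    then have "eventually (\<lambda>u. bessel_entire (p + 1) (\<zeta> + u) \<noteq> 0) (nhds 0)"
      by (rule tendsto_imp_eventually_ne) (use Q0 in simp)
    moreover have "eventually (\<lambda>u. u \<in> {-\<zeta><..}) (nhds 0)"
      using pos by (intro eventually_nhds_in_open) auto
    ultimately show ?thesis by eventually_elim auto
  qed
  \<comment> \<open>Positions of the poles relative to \<zeta>. They are nonzero because the orders
    \<open>p\<close> and \<open>p + 1\<close> share no zero.\<close>
  define w where "w m = z m - \<zeta>" for m
  have w0: "w m \<noteq> 0" for m using z(3)[of \<zeta>] Q0 by (auto simp: w_def)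
  \<comment> \<open>The partial fraction expansion at the origin, where the entire function is
    1.\<close>
  have "summable (\<lambda>j. 1 / z j)" using sums_summable[OF z(4)[of 0]] by simp
  then have summ: "summable (\<lambda>m. \<bar>1 / w m\<bar>)"
    unfolding w_def by (rule summable_inverse_shift) (rule z(2))
  define g where "g u = bessel_A p (\<zeta> + u)" for u
  define S where "S k = (\<Sum>m. 1 / w m ^ k)" for k
  \<comment> \<open>The expansion of
    \<open>2 (p + 1) / (\<zeta> + u) - 2 \<Sum> 1 / (w m - u)\<close> in powers of
    \<open>u\<close>.\<close>
  define a where "a k = 2 * (p + 1) * ((-1) ^ k / \<zeta> ^ Suc k) - 2 * S (Suc k)" for k
  have g_exp: "g has_fps_expansion Abs_fps a"
  proof -
    have "(\<lambda>u. 2 * (p + 1) * (1 / (\<zeta> + u)) - 2 * (\<Sum>m. 1 / (w m - u))) has_fps_expansion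
        fps_const (2 * (p + 1)) * Abs_fps (\<lambda>k. (-1) ^ k / \<zeta> ^ Suc k)
        - fps_const 2 * Abs_fps (\<lambda>k. \<Sum>m. 1 / w m ^ Suc k)"
      using pos by (intro fps_expansion_intros has_fps_expansion_inverse_shift
          has_fps_expansion_partial_fractions summ w0) auto
    moreover have "fps_const (2 * (p + 1)) * Abs_fps (\<lambda>k. (-1) ^ k / \<zeta> ^ Suc k)
        - fps_const 2 * Abs_fps (\<lambda>k. \<Sum>m. 1 / w m ^ Suc k) = Abs_fps a"
      by (rule fps_ext) (simp add: a_def S_def)
    moreover have "eventually (\<lambda>u. 2 * (p + 1) * (1 / (\<zeta> + u)) - 2 * (\<Sum>m. 1 / (w m - u)) = g u) (nhds 0)"
      using near
    proof eventually_elim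
      case (elim u)
      have "w m - u = z m - (\<zeta> + u)" for m by (simp add: w_def)
      then have "(\<Sum>m. 1 / (w m - u)) = bessel_entire (p + 1 + 1) (\<zeta> + u) / (4 * (p + 1 + 1) * bessel_entire (p + 1) (\<zeta> + u))"
        using sums_unique[OF z(4)[OF elim[THEN conjunct2]]] by (simp only:)
      moreover have "bessel_A p (\<zeta> + u) = 2 * (p + 1) / (\<zeta> + u)
          - 2 * (bessel_entire (p + 1 + 1) (\<zeta> + u) / (4 * (p + 1 + 1) * bessel_entire (p + 1) (\<zeta> + u)))"
        using elim by (intro bessel_A_partial_fractions assms(1)) auto
      ultimately show ?case by (simp only: g_def times_divide_eq_right mult_1_right)
    qed
    ultimately show ?thesis
      unfolding has_fps_expansion_def by (auto elim: eventually_elim2)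
  qed
  have \<alpha>_nth: "\<alpha> k = a k" for k
    using has_fps_expansion_imp_fps_nth[OF g_exp, of k] higher_deriv_shift_0[of k "bessel_A p" \<zeta>]
    by (simp add: assms(4) g_def[abs_def] o_def)
  then have \<alpha>_eq: "\<alpha> = a" by blast
  have \<alpha>0: "\<alpha> 0 = 0"
    using bessel_A_eq[OF assms(1) pos] P0 assms(4)[of 0] by simp
  have ode: "eventually (\<lambda>u. 2 * (\<zeta> + u) * deriv g u = 2 * p * g u - 1 - (\<zeta> + u) * (g u)\<^sup>2) (nhds 0)"
    using near
  proof eventually_elim
    case (elim u)
    have "(g has_real_derivative
        (2 * p * g u - 1 - (\<zeta> + u) * (g u)\<^sup>2) / (2 * (\<zeta> + u))) (at u)"
    proof -
      have "(bessel_A p has_real_derivative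
          (2 * p * g u - 1 - (\<zeta> + u) * (g u)\<^sup>2) / (2 * (\<zeta> + u))) (at (u + \<zeta>))"
        using has_real_derivative_bessel_A[OF assms(1), of "u + \<zeta>"] elim by (simp add: g_def add.commute)
      then show ?thesis
        unfolding DERIV_shift by (simp add: g_def[abs_def] add.commute)
    qed
    then have "deriv g u = (2 * p * g u - 1 - (\<zeta> + u) * (g u)\<^sup>2) / (2 * (\<zeta> + u))"
      by (rule DERIV_imp_deriv)
    then show ?case using elim by simp
  qed
  note taylor = riccati_taylor_coefficients[OF _ g_exp[folded \<alpha>_eq] \<alpha>0 ode]
  have sums_w: "(\<lambda>m. 1 / w m ^ Suc k) sums S (Suc k)" for k
  proof -
    have "summable (\<lambda>m. 1 / w m ^ Suc k)"
    proof (rule summable_comparison_test_ev)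
      show "summable (\<lambda>m. \<bar>1 / w m\<bar>)" by (rule summ)
      have "(\<lambda>m. \<bar>1 / w m\<bar>) \<longlonglongrightarrow> 0" by (rule summable_LIMSEQ_zero[OF summ])
      then have "eventually (\<lambda>m. \<bar>1 / w m\<bar> < 1) sequentially" by (rule order_tendstoD) simp
      then show "eventually (\<lambda>m. norm (1 / w m ^ Suc k) \<le> \<bar>1 / w m\<bar>) sequentially"
      proof eventually_elim
        case (elim m)
        then have "\<bar>1 / w m\<bar> ^ Suc k \<le> \<bar>1 / w m\<bar>" using power_decreasing[of 1 "Suc k" "\<bar>1 / w m\<bar>"] by simp
        then show ?case by (simp add: power_abs power_divide abs_mult)
      qed
    qed
    then show ?thesis unfolding S_def by (rule summable_sums)
  qed
  have sum: "(\<lambda>m. \<zeta> * z m / (z m - \<zeta>) ^ r) sums (- (1 / 2) * (\<zeta> * \<alpha> (r - 2) + \<zeta>\<^sup>2 * \<alpha> (r - 1)))"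
    if r: "r \<ge> 2" for r
  proof -
    obtain k where k: "r = Suc (Suc k)" using r by (metis add_2_eq_Suc le_Suc_ex)
    have "(\<lambda>m. \<zeta> * (1 / w m ^ Suc k) + \<zeta>\<^sup>2 * (1 / w m ^ Suc (Suc k))) sums (\<zeta> * S (Suc k) + \<zeta>\<^sup>2 * S (Suc (Suc k)))"
      by (intro sums_add sums_mult sums_w)
    moreover have "\<zeta> * (1 / w m ^ Suc k) + \<zeta>\<^sup>2 * (1 / w m ^ Suc (Suc k)) = \<zeta> * z m / (z m - \<zeta>) ^ r" for m
    proof -
      have "z m = w m + \<zeta>" by (simp add: w_def)
      moreover have "\<zeta> * (1 / w m ^ Suc k) + \<zeta>\<^sup>2 * (1 / w m ^ Suc (Suc k)) = \<zeta> * (w m + \<zeta>) / w m ^ r"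
        using w0[of m] unfolding k by (simp add: field_simps power2_eq_square)
      ultimately show ?thesis by simp
    qed
    \<comment> \<open>The contributions of \<open>2 (p + 1) / (\<zeta> + u)\<close> to the two
      coefficients have opposite signs and cancel after weighting by \<zeta> and
      \<open>\<zeta>^2\<close>.\<close>
    moreover have "\<zeta> * S (Suc k) + \<zeta>\<^sup>2 * S (Suc (Suc k)) = - (1 / 2) * (\<zeta> * \<alpha> (r - 2) + \<zeta>\<^sup>2 * \<alpha> (r - 1))"
      using pos unfolding \<alpha>_eq a_def k by (simp add: field_simps power2_eq_square)
    ultimately show ?thesis by simp
  qed
  have four: "bessel_zero p n ^ 4 = \<zeta>\<^sup>2"
    by (simp add: assms(3) flip: power_mult)
  show ?thesis
    using \<alpha>0 taylor pos sum by (simp add: zero four flip: assms(3))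
qed

end
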